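(* (a) Let $U$ be a fundamental solution matrix at $t=0$ (of weight $\kappa_U\in\mathbb Z^r$) and $V$ a fundamental solution matrix at $t=\infty$ (of weight $\kappa_V\in\mathbb Z^r$) of a linear $q$-difference equation $X(qt,q)=A(t,q)X(t,q)$, with $A\in \mathrm{GL}_r(\mathbb Q(t,q))$, and let $M=V^{-1}U$ be the monodromy matrix, viewed as a function of $(z,\tau)$. If the equation $$M=\Delta_{\kappa_V,\gamma}\,(M|_{\kappa_U}\gamma)$$ holds for $\gamma=S$ and for $\gamma=T$, then it holds for all $\gamma\in \mathrm{SL}_2(\mathbb Z)$. (b) If $\Omega$ is an $\mathrm{SL}_2(\mathbb Z)$-cocycle with $\Omega_T=I$, then $\Omega_S$ satisfies $$1=\Omega_S\Big(-\frac z\tau,-\frac1\tau\Big)\,\Omega_S(-z,\tau)\,\Omega_S\Big(\frac z\tau,-\frac1\tau\Big)\,\Omega_S(z,\tau),$$ $$\Omega_S(z,\tau)=\Omega_S\Big(\frac{z}{\tau+1},\frac{\tau}{\tau+1}\Big)\,\Omega_S(z,\tau+1).$$ Conversely, given $\Omega_T=I$ and an invertible matrix-valued function $\Omega_S$ satisfying these two functional equations, there is an $\mathrm{SL}_2(\mathbb Z)$-cocycle with these values at $T$ and $S$. (c) If $\Omega$ is an $\mathrm{SL}_2(\mathbb Z)$-cocycle such that $\Omega_T=I$ and $\Omega_S$ extends to a meromorphic function of $(z,\tau)\in\mathbb C\times\mathbb C'$, where $\mathbb C'=\mathbb C\setminus(-\infty,0]$, then for every $\gamma\in \mathrm{SL}_2(\mathbb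 Z)$ the function $\Omega_\gamma$ extends to a meromorphic function of $(z,\tau)\in\mathbb C\times\mathbb C_\gamma$.
   Context: Notation: $\mathbf e(x)=e^{2\pi i x}$, $q=\mathbf e(\tau)$, $t=\mathbf e(z)$, $\tau\in\mathbb C\setminus\mathbb R$, $z\in\mathbb C$; $S=\begin{pmatrix}0&-1\\1&0\end{pmatrix}$, $T=\begin{pmatrix}1&1\\0&1\end{pmatrix}$. The group $\mathrm{SL}_2(\mathbb Z)$ acts by $\gamma(z,\tau)=\left(\frac{z}{c\tau+d},\frac{a\tau+b}{c\tau+d}\right)$ for $\gamma=\begin{pmatrix}a&b\\c&d\end{pmatrix}$. Slash operator: for an $r\times r$ matrix-valued function $F(z,\tau)$ and $\kappa=(\kappa_1,\dots,\kappa_r)\in\mathbb Z^r$, $(F|_\kappa\gamma)(z,\tau)=F(\gamma(z,\tau))\,\mathrm{diag}((c\tau+d)^{-\kappa_1},\dots,(c\tau+d)^{-\kappa_r})$, and $\Delta_{\kappa,\gamma}(\tau)=\mathrm{diag}((c\tau+d)^{\kappa_1},\dots,(c\tau+d)^{\kappa_r})$. A fundamental solution matrix is an invertible $r\times r$ matrix of functions, meromorphic in $z$ and in $\tau\in\mathbb C\setminus\mathbb R$, whose columns solve the equation. An $\mathrm{SL}_2(\mathbb Z)$-cocycle is a family $\gamma\mapsto\Omega_\gamma$ ($\gamma\in\mathrm{SL}_2(\mathbb Z)$) of invertible $r\times r$ matrices of meromorphic functions of $(z,\tau)\in\mathbb C\times(\mathbb C\setminus\mathbb R)$ such that $\Omega_{\gamma\gamma'}(z,\tau)=\Omega_\gamma(\gamma'(z,\tau))\,\Omega_{\gamma'}(z,\tau)$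 for all $\gamma,\gamma'$. For $\gamma=\begin{pmatrix}a&b\\c&d\end{pmatrix}$, the cut plane $\mathbb C_\gamma$ is $\mathbb C\setminus(-\infty,-d/c]$ if $c>0$, $\mathbb C\setminus[-d/c,\infty)$ if $c<0$, and $\mathbb C\setminus\mathbb R$ if $c=0$. *)

theory Defs
  imports "HOL-Analysis.Analysis" "HOL-Computational_Algebra.Computational_Algebra"
    "HOL-Computational_Algebra.Field_as_Ring"
begin

section \<open>Meromorphic functions of two complex variables\<close>

definition holomorphic2_on :: "(complex \<times> complex \<Rightarrow> complex) \<Rightarrow> (complex \<times> complex) set \<Rightarrow> bool" where
  "holomorphic2_on f W \<longleftrightarrow>
     (\<forall>p\<in>W. \<exists>a b. (f has_derivative (\<lambda>(u, v). a * u + b * v)) (at p))"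

text \<open>
  As for one-variable meromorphic functions in the library, a meromorphic function is
  represented by a total function whose values on a small set (here, the zero set of a
  local denominator) are irrelevant. The denominator is required not to vanish
  identically on any nonempty open part of the neighbourhood.
\<close>

definition meromorphic2_on :: "(complex \<times> complex \<Rightarrow> complex) \<Rightarrow> (complex \<times> complex) set \<Rightarrow> bool" where
  "meromorphic2_on f D \<longleftrightarrow>
     (\<forall>p\<in>D. \<exists>W g h. open W \<and> p \<in> W \<and> holomorphic2_on g W \<and> holomorphic2_on h W \<and>
        (\<forall>V. open V \<and> V \<noteq> {} \<and> V \<subseteq> W \<longrightarrow> (\<exists>x\<in>V. h x \<noteq> 0)) \<and>
        (\<forall>x\<in>W. h x \<noteq> 0 \<longrightarrow> f x = g x / h x))"

text \<open>
  Equality of meromorphic functions on an open set \<open>D\<close>: the representing total functions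
  agree on a dense open subset of \<open>D\<close>.
\<close>

definition mero_eq :: "(complex \<times> complex) set \<Rightarrow> (complex \<times> complex \<Rightarrow> 'b) \<Rightarrow> (complex \<times> complex \<Rightarrow> 'b) \<Rightarrow> bool" where
  "mero_eq D f g \<longleftrightarrow> D \<subseteq> closure (interior {p \<in> D. f p = g p})"

definition mero_matrix :: "(complex \<times> complex) set \<Rightarrow> (complex \<times> complex \<Rightarrow> complex ^ 'n ^ 'n) \<Rightarrow> bool" where
  "mero_matrix D F \<longleftrightarrow> (\<forall>i j. meromorphic2_on (\<lambda>p. F p $ i $ j) D)"

definition invertible_mero_matrix :: "(complex \<times> complex) set \<Rightarrow> (complex \<times> complex \<Rightarrow> complex ^ 'n ^ 'n) \<Rightarrow> bool" where
  "invertible_mero_matrix D F \<longleftrightarrow> mero_matrix D F \<and>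
     (\<exists>G. mero_matrix D G \<and> mero_eq D (\<lambda>p. F p ** G p) (\<lambda>_. mat 1)
                          \<and> mero_eq D (\<lambda>p. G p ** F p) (\<lambda>_. mat 1))"

definition extends_mero :: "(complex \<times> complex) set \<Rightarrow> (complex \<times> complex) set \<Rightarrow> (complex \<times> complex \<Rightarrow> complex ^ 'n ^ 'n) \<Rightarrow> bool" where
  "extends_mero D E F \<longleftrightarrow> (\<exists>G. mero_matrix E G \<and> mero_eq D G F)"

section \<open>The modular group\<close>

definition SL2Z :: "(int ^ 2 ^ 2) set" where
  "SL2Z = {\<gamma>. det \<gamma> = 1}"

definition S_mat :: "int ^ 2 ^ 2" where
  "S_mat = vector [vector [0, -1], vector [1, 0]]"

definition T_mat :: "int ^ 2 ^ 2" where
  "T_mat = vector [vector [1, 1], vector [0, 1]]"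

definition autf :: "int ^ 2 ^ 2 \<Rightarrow> complex \<Rightarrow> complex" where
  "autf \<gamma> \<tau> = of_int (\<gamma> $ 2 $ 1) * \<tau> + of_int (\<gamma> $ 2 $ 2)"

definition act :: "int ^ 2 ^ 2 \<Rightarrow> complex \<times> complex \<Rightarrow> complex \<times> complex" where
  "act \<gamma> = (\<lambda>(z, \<tau>). (z / autf \<gamma> \<tau>,
                      (of_int (\<gamma> $ 1 $ 1) * \<tau> + of_int (\<gamma> $ 1 $ 2)) / autf \<gamma> \<tau>))"

text \<open>Pairs are \<open>(z, \<tau>)\<close> throughout, so this is \<open>\<complex> \<times> (\<complex> - \<real>)\<close>.\<close>

definition dom0 :: "(complex \<times> complex) set" where
  "dom0 = UNIV \<times> (- \<real>)"

definition diag_mat :: "('n \<Rightarrow> complex) \<Rightarrow> complex ^ 'n ^ 'n" where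
  "diag_mat d = (\<chi> i j. if i = j then d i else 0)"

definition Delta :: "int ^ 'n \<Rightarrow> int ^ 2 ^ 2 \<Rightarrow> complex \<Rightarrow> complex ^ 'n ^ 'n" where
  "Delta \<kappa> \<gamma> \<tau> = diag_mat (\<lambda>i. autf \<gamma> \<tau> powi (\<kappa> $ i))"

definition slash :: "(complex \<times> complex \<Rightarrow> complex ^ 'n ^ 'n) \<Rightarrow> int ^ 'n \<Rightarrow> int ^ 2 ^ 2
    \<Rightarrow> complex \<times> complex \<Rightarrow> complex ^ 'n ^ 'n" where
  "slash F \<kappa> \<gamma> = (\<lambda>(z, \<tau>). F (act \<gamma> (z, \<tau>)) ** diag_mat (\<lambda>i. autf \<gamma> \<tau> powi (- (\<kappa> $ i))))"

definition cut_plane :: "int ^ 2 ^ 2 \<Rightarrow> complex set" where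
  "cut_plane \<gamma> =
    (let c = \<gamma> $ 2 $ 1; d = \<gamma> $ 2 $ 2; x = - real_of_int d / real_of_int c
     in if c > 0 then - (complex_of_real ` {..x})
        else if c < 0 then - (complex_of_real ` {x..})
        else - \<real>)"

section \<open>Linear \<open>q\<close>-difference equations\<close>

text \<open>
  The field \<open>\<rat>(t,q)\<close> is the fraction field of \<open>\<rat>[q][t]\<close>: the outer polynomial variable is
  \<open>t\<close>, the inner one is \<open>q\<close>. A rational function is evaluated through its reduced fraction;
  where the denominator vanishes the value is irrelevant.
\<close>

definition eval_poly2 :: "rat poly poly \<Rightarrow> complex \<Rightarrow> complex \<Rightarrow> complex" where
  "eval_poly2 P t q = poly (map_poly (\<lambda>p. poly (map_poly of_rat p) q) P) t"

definition eval_ratfun :: "rat poly poly fract \<Rightarrow> complex \<Rightarrow> complex \<Rightarrow> complex" where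
  "eval_ratfun f t q =
     eval_poly2 (fst (quot_of_fract f)) t q / eval_poly2 (snd (quot_of_fract f)) t q"

definition eval_ratmat :: "rat poly poly fract ^ 'n ^ 'n \<Rightarrow> complex \<Rightarrow> complex \<Rightarrow> complex ^ 'n ^ 'n" where
  "eval_ratmat A t q = (\<chi> i j. eval_ratfun (A $ i $ j) t q)"

definition ee :: "complex \<Rightarrow> complex" where
  "ee x = exp (2 * of_real pi * \<i> * x)"

text \<open>
  Solutions are functions of \<open>(z, \<tau>)\<close>; with \<open>t = ee z\<close> and \<open>q = ee \<tau>\<close>, the substitution
  \<open>t \<mapsto> q t\<close> is \<open>z \<mapsto> z + \<tau>\<close>.
\<close>

definition solves_qdiff :: "rat poly poly fract ^ 'n ^ 'n \<Rightarrow> (complex \<times> complex \<Rightarrow> complex ^ 'n) \<Rightarrow> bool" where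
  "solves_qdiff A X \<longleftrightarrow>
     mero_eq dom0 (\<lambda>(z, \<tau>). X (z + \<tau>, \<tau>)) (\<lambda>(z, \<tau>). eval_ratmat A (ee z) (ee \<tau>) *v X (z, \<tau>))"

definition fundamental_solution :: "rat poly poly fract ^ 'n ^ 'n
    \<Rightarrow> (complex \<times> complex \<Rightarrow> complex ^ 'n ^ 'n) \<Rightarrow> bool" where
  "fundamental_solution A U \<longleftrightarrow>
     invertible_mero_matrix dom0 U \<and> (\<forall>j. solves_qdiff A (\<lambda>p. column j (U p)))"

definition monodromy :: "(complex \<times> complex \<Rightarrow> complex ^ 'n ^ 'n) \<Rightarrow> (complex \<times> complex \<Rightarrow> complex ^ 'n ^ 'n)
    \<Rightarrow> complex \<times> complex \<Rightarrow> complex ^ 'n ^ 'n" where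
  "monodromy U V = (\<lambda>p. matrix_inv (V p) ** U p)"

definition modular_eq :: "int ^ 'n \<Rightarrow> int ^ 'n \<Rightarrow> (complex \<times> complex \<Rightarrow> complex ^ 'n ^ 'n)
    \<Rightarrow> int ^ 2 ^ 2 \<Rightarrow> bool" where
  "modular_eq \<kappa>\<^sub>U \<kappa>\<^sub>V M \<gamma> \<longleftrightarrow>
     mero_eq dom0 M (\<lambda>(z, \<tau>). Delta \<kappa>\<^sub>V \<gamma> \<tau> ** slash M \<kappa>\<^sub>U \<gamma> (z, \<tau>))"

section \<open>Cocycles\<close>

definition SL2Z_cocycle :: "(int ^ 2 ^ 2 \<Rightarrow> complex \<times> complex \<Rightarrow> complex ^ 'n ^ 'n) \<Rightarrow> bool" where
  "SL2Z_cocycle \<Omega> \<longleftrightarrow>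
     (\<forall>\<gamma>\<in>SL2Z. invertible_mero_matrix dom0 (\<Omega> \<gamma>)) \<and>
     (\<forall>\<gamma>\<in>SL2Z. \<forall>\<gamma>'\<in>SL2Z.
        mero_eq dom0 (\<Omega> (\<gamma> ** \<gamma>')) (\<lambda>p. \<Omega> \<gamma> (act \<gamma>' p) ** \<Omega> \<gamma>' p))"

definition S_equations :: "(complex \<times> complex \<Rightarrow> complex ^ 'n ^ 'n) \<Rightarrow> bool" where
  "S_equations W \<longleftrightarrow>
     mero_eq dom0 (\<lambda>_. mat 1)
       (\<lambda>(z, \<tau>). W (- z / \<tau>, - 1 / \<tau>) ** W (- z, \<tau>) ** W (z / \<tau>, - 1 / \<tau>) ** W (z, \<tau>)) \<and>
     mero_eq dom0 W
       (\<lambda>(z, \<tau>). W (z / (\<tau> + 1), \<tau> / (\<tau> + 1)) ** W (z, \<tau> + 1))"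

end

theory Submission
  imports Defs
begin

text \<open>
  Everything rests on the presentation of \<open>SL\<^sub>2(\<int>)\<close> by \<open>S\<close> and \<open>T\<close> with relations \<open>S\<^sup>4 = 1\<close> and
  \<open>S = T S T S T\<close>. The modular equation for \<open>M\<close> is stable under products because \<open>c\<tau> + d\<close> is a
  cocycle. When \<open>\<Omega>\<^sub>T = I\<close>, the two equations for \<open>\<Omega>\<^sub>S\<close> are the cocycle identities of the two
  relations; conversely one defines \<open>\<Omega>\<^sub>\<gamma>\<close> along the Euclidean algorithm on the first column of \<open>\<gamma>\<close>
  and checks by induction that left multiplication by \<open>S\<close> behaves correctly, the relations being
  exactly what compensates for a different sequence of quotients. For the extension to
  \<open>\<complex> \<times> \<complex>\<^sub>\<gamma>\<close> with \<open>c > 0\<close>, write \<open>\<gamma> = T\<^sup>k S \<delta>\<close>, where \<open>\<delta>\<close> has rows \<open>(c, d)\<close> and \<open>(e, f)\<close> with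
  \<open>0 \<le> e < c\<close>: the cut of \<open>\<delta>\<close> lies inside that of \<open>\<gamma>\<close>, and \<open>\<delta>\<close> maps the cut plane of \<open>\<gamma>\<close> into that
  of \<open>S\<close>. The case \<open>c < 0\<close> follows by inverting \<open>\<Omega>\<^bsub>\<gamma>\<^sup>-\<^sup>1\<^esub>\<close>.
\<close>

unbundle no Formal_Power_Series.fps_syntax

section \<open>Presentation of the modular group\<close>

text \<open>Named entries reduce every identity between words in \<open>S_mat\<close> and
  \<open>T_mat\<close> to four integer identities, which \<open>simp\<close> decides.\<close>

definition mat2 :: "int \<Rightarrow> int \<Rightarrow> int \<Rightarrow> int \<Rightarrow> int ^ 2 ^ 2" where
  "mat2 a b c d = vector [vector [a, b], vector [c, d]]"

lemma mat2_nth [simp]: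
  "mat2 a b c d $ 1 $ 1 = a" "mat2 a b c d $ 1 $ 2 = b"
  "mat2 a b c d $ 2 $ 1 = c" "mat2 a b c d $ 2 $ 2 = d"
  by (simp_all add: mat2_def)

lemma mat2_eq_iff: "\<gamma> = \<gamma>' \<longleftrightarrow> \<gamma> $ 1 $ 1 = \<gamma>' $ 1 $ 1 \<and> \<gamma> $ 1 $ 2 = \<gamma>' $ 1 $ 2 \<and>
    \<gamma> $ 2 $ 1 = \<gamma>' $ 2 $ 1 \<and> \<gamma> $ 2 $ 2 = (\<gamma>' :: int ^ 2 ^ 2) $ 2 $ 2"
  by (auto simp: vec_eq_iff forall_2)

lemma mat2_cases [case_names mat2]:
  fixes \<gamma> :: "int ^ 2 ^ 2"
  obtains a b c d where "\<gamma> = mat2 a b c d"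
  using mat2_eq_iff by (metis mat2_nth)

lemma mat2_mult [simp]:
  "mat2 a b c d ** mat2 a' b' c' d' =
     mat2 (a * a' + b * c') (a * b' + b * d') (c * a' + d * c') (c * b' + d * d')"
  by (simp add: mat2_eq_iff matrix_matrix_mult_def sum_2)

lemma mat2_uminus [simp]: "- mat2 a b c d = mat2 (- a) (- b) (- c) (- d)"
  by (simp add: mat2_eq_iff)

lemma mat2_one: "mat 1 = mat2 1 0 0 1"
  by (simp add: mat2_eq_iff mat_def)

lemma S_mat_eq: "S_mat = mat2 0 (- 1) 1 0" and T_mat_eq: "T_mat = mat2 1 1 0 1"
  by (simp_all add: S_mat_def T_mat_def mat2_def)

lemma mat2_SL2Z [simp]: "mat2 a b c d \<in> SL2Z \<longleftrightarrow> a * d - b * c = 1"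
  by (simp add: SL2Z_def det_2)

lemma SL2Z_mult [simp]: "\<gamma> \<in> SL2Z \<Longrightarrow> \<gamma>' \<in> SL2Z \<Longrightarrow> \<gamma> ** \<gamma>' \<in> SL2Z"
  by (simp add: SL2Z_def det_mul)

lemma SL2Z_generators [simp]: "S_mat \<in> SL2Z" "T_mat \<in> SL2Z" "mat 1 \<in> SL2Z"
  by (simp_all add: S_mat_eq T_mat_eq mat2_one)

lemma SL2Z_uminus [simp]: "\<gamma> \<in> SL2Z \<Longrightarrow> - \<gamma> \<in> SL2Z"
  by (cases \<gamma> rule: mat2_cases) simp

definition Tpow :: "int \<Rightarrow> int ^ 2 ^ 2" where
  "Tpow k = mat2 1 k 0 1"

text \<open>The adjugate: a polynomial formula with integer entries, inverse to a matrix of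
  determinant one.\<close>

definition SL2Z_inv :: "int ^ 2 ^ 2 \<Rightarrow> int ^ 2 ^ 2" where
  "SL2Z_inv \<gamma> = mat2 (\<gamma> $ 2 $ 2) (- \<gamma> $ 1 $ 2) (- \<gamma> $ 2 $ 1) (\<gamma> $ 1 $ 1)"

lemma Tpow_SL2Z [simp]: "Tpow k \<in> SL2Z"
  by (simp add: Tpow_def)

lemma Tpow_add: "Tpow (j + k) = Tpow j ** Tpow k"
  by (simp add: Tpow_def add.commute)

lemma Tpow_0: "Tpow 0 = mat 1" and Tpow_1: "Tpow 1 = T_mat"
  by (simp_all add: Tpow_def mat2_one T_mat_eq)

lemma SL2Z_inv:
  assumes "\<gamma> \<in> SL2Z"
  shows "SL2Z_inv \<gamma> \<in> SL2Z" "SL2Z_inv \<gamma> ** \<gamma> = mat 1" "\<gamma> ** SL2Z_inv \<gamma> = mat 1"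
  using assms by (cases \<gamma> rule: mat2_cases; simp add: SL2Z_inv_def mat2_one algebra_simps)+

lemma SL2Z_cases_c0:
  assumes "\<gamma> \<in> SL2Z" "\<gamma> $ 2 $ 1 = 0"
  obtains k where "\<gamma> = Tpow k" | k where "\<gamma> = - Tpow k"
proof (cases \<gamma> rule: mat2_cases)
  case (mat2 a b c d)
  then have "c = 0" "a * d = 1" using assms by auto
  then have "a = 1 \<and> d = 1 \<or> a = - 1 \<and> d = - 1" by (auto simp: zmult_eq_1_iff)
  with mat2 \<open>c = 0\<close> show ?thesis
    using that(1)[of b] that(2)[of "- b"] by (auto simp: Tpow_def)
qed

text \<open>One step of the Euclidean algorithm on the first column: the matrix
  \<open>S\<^sup>-\<^sup>1 T\<^sup>-\<^sup>k \<gamma>\<close> with \<open>k = a div c\<close>.\<close>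

definition euclid_step :: "int ^ 2 ^ 2 \<Rightarrow> int ^ 2 ^ 2" where
  "euclid_step \<gamma> = mat2 (\<gamma> $ 2 $ 1) (\<gamma> $ 2 $ 2) (- (\<gamma> $ 1 $ 1 mod \<gamma> $ 2 $ 1))
     (\<gamma> $ 1 $ 1 div \<gamma> $ 2 $ 1 * \<gamma> $ 2 $ 2 - \<gamma> $ 1 $ 2)"

lemma euclid_step_eq: "\<gamma> = Tpow (\<gamma> $ 1 $ 1 div \<gamma> $ 2 $ 1) ** (S_mat ** euclid_step \<gamma>)"
  by (cases \<gamma> rule: mat2_cases) (simp add: euclid_step_def S_mat_eq Tpow_def minus_div_mult_eq_mod [symmetric] algebra_simps)

lemma euclid_step_SL2Z [simp]: "\<gamma> \<in> SL2Z \<Longrightarrow> euclid_step \<gamma> \<in> SL2Z"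
  by (cases \<gamma> rule: mat2_cases) (simp add: euclid_step_def minus_div_mult_eq_mod [symmetric] algebra_simps)

lemma euclid_step_less: "\<gamma> $ 2 $ 1 \<noteq> 0 \<Longrightarrow> \<bar>euclid_step \<gamma> $ 2 $ 1\<bar> < \<bar>\<gamma> $ 2 $ 1\<bar>"
  by (simp add: euclid_step_def abs_mod_less)

text \<open>Left multiplication by \<open>Tpow k\<close> adds \<open>k\<close> to the quotient and
  keeps the remainder. This is why the recursion below is blind to powers of
  \<open>T\<close>.\<close>

lemma euclid_step_Tpow: "\<gamma> $ 2 $ 1 \<noteq> 0 \<Longrightarrow> euclid_step (Tpow k ** \<gamma>) = euclid_step \<gamma>"
  by (cases \<gamma> rule: mat2_cases) (simp add: euclid_step_def Tpow_def algebra_simps)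

lemma euclid_step_uminus: "euclid_step (- \<gamma>) = - euclid_step \<gamma>"
  by (cases \<gamma> rule: mat2_cases) (simp add: euclid_step_def algebra_simps mod_minus_minus)

lemma Tpow_induct:
  fixes \<gamma> :: "int ^ 2 ^ 2"
  assumes "P \<gamma>" "\<And>k. P (Tpow k ** \<gamma>) \<Longrightarrow> P (Tpow (k + 1) ** \<gamma>)"
    "\<And>k. P (Tpow k ** \<gamma>) \<Longrightarrow> P (Tpow (k - 1) ** \<gamma>)"
  shows "P (Tpow k ** \<gamma>)"
proof (induction k rule: int_induct [where k = 0])
  case base
  then show ?case using assms(1) by (simp add: Tpow_0)
qed (use assms in auto)

text \<open>The Euclidean algorithm on the first column stops at \<open>c = 0\<close>, where only a
  signed power of \<open>T\<close> is left. There is no clause for inverses because both T^-1 and -1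
  are positive words in the generators.\<close>

lemma SL2Z_induct [consumes 1, case_names one S T]:
  assumes "\<gamma> \<in> SL2Z"
    and one: "P (mat 1)"
    and S: "\<And>\<gamma>. \<gamma> \<in> SL2Z \<Longrightarrow> P \<gamma> \<Longrightarrow> P (S_mat ** \<gamma>)"
    and T: "\<And>\<gamma>. \<gamma> \<in> SL2Z \<Longrightarrow> P \<gamma> \<Longrightarrow> P (T_mat ** \<gamma>)"
  shows "P \<gamma>"
proof -
  have Tinv: "P (Tpow (- 1) ** \<gamma>)" if "P \<gamma>" "\<gamma> \<in> SL2Z" for \<gamma>
  proof -
    \<comment> \<open>The relation S = TSTST solved for T^-1, with S^-1 written as S^3.\<close>
    have "Tpow (- 1) ** \<gamma> = S_mat ** (T_mat ** (S_mat ** (T_mat ** (S_mat ** (S_mat ** (S_mat ** \<gamma>))))))"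
      by (cases \<gamma> rule: mat2_cases) (simp add: S_mat_eq T_mat_eq Tpow_def)
    then show ?thesis using that by (auto intro!: S T)
  qed
  have Tk: "P (Tpow k ** \<gamma>)" if "P \<gamma>" "\<gamma> \<in> SL2Z" for \<gamma> k
  proof (rule Tpow_induct)
    fix k assume IH: "P (Tpow k ** \<gamma>)"
    show "P (Tpow (k + 1) ** \<gamma>)"
      using T [OF _ IH] that Tpow_add [of 1 k] by (simp add: Tpow_1 matrix_mul_assoc add.commute)
    show "P (Tpow (k - 1) ** \<gamma>)"
      using Tinv [OF IH] that Tpow_add [of "- 1" k] by (simp add: matrix_mul_assoc)
  qed (fact that(1))
  show ?thesis using assms(1)
  proof (induction "nat \<bar>\<gamma> $ 2 $ 1\<bar>" arbitrary: \<gamma> rule: less_induct)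
    case less
    show ?case
    proof (cases "\<gamma> $ 2 $ 1 = 0")
      case True
      have minus: "- Tpow k = Tpow k ** (S_mat ** (S_mat ** mat 1))" for k
        by (simp add: Tpow_def S_mat_eq mat2_one)
      show ?thesis using less.prems True
      proof (cases rule: SL2Z_cases_c0)
        case (1 k)
        then show ?thesis using Tk [OF one, of k] by simp
      next
        case (2 k)
        show ?thesis unfolding 2 minus by (intro Tk S one) auto
      qed
    next
      case False
      then have "P (euclid_step \<gamma>)"
        using less.prems euclid_step_less [of \<gamma>] by (intro less.hyps) auto
      then show ?thesis using less.prems by (subst euclid_step_eq) (auto intro!: Tk S)
    qed
  qed
qed

section \<open>Integer quotients equal to 0 or -1\<close>

lemma div_small:
  fixes a c :: int
  assumes "\<bar>a\<bar> < \<bar>c\<bar>"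
  shows "a div c = 0 \<or> a div c = - 1"
proof (cases "c > 0")
  case True
  then show ?thesis
    using assms int_div_pos_eq [of a c 0 a] int_div_pos_eq [of a c "- 1" "a + c"]
    by (cases "a \<ge> 0") auto
next
  case False
  then show ?thesis
    using assms int_div_neg_eq [of a c 0 a] int_div_neg_eq [of a c "- 1" "a + c"]
    by (cases "a \<le> 0") auto
qed

text \<open>The remainder of \<open>- c\<close> is \<open>a - c\<close>, and it has the sign of
  \<open>a\<close> and smaller absolute value. So \<open>c\<close> lies between 0 and
  \<open>a\<close>, which makes \<open>c - a\<close> a smaller entry in
  \<open>orbit_S\<close>.\<close>

lemma div_eq_minus_one:
  fixes a c :: int
  assumes "a \<noteq> 0" "- c div a = - 1"
  shows "0 < c \<and> c \<le> a \<or> c < 0 \<and> a \<le> c"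
proof -
  define m where "m = (- c) mod a"
  have "a * (- 1) + m = - c" unfolding m_def using assms(2) by (metis mult_div_mod_eq)
  moreover have "a > 0 \<longrightarrow> 0 \<le> m \<and> m < a" "a < 0 \<longrightarrow> m \<le> 0 \<and> a < m"
    by (auto simp: m_def)
  ultimately show ?thesis using assms(1) by linarith
qed

text \<open>The first columns of \<open>\<gamma>\<close> and \<open>S_mat ** \<gamma>\<close> are
  (a, c) and (-c, a). Dividing the entry of smaller absolute value by the larger one gives 0 or -1,
  and a tie is settled by its sign; hence one of the two matrices always has a harmless
  quotient.\<close>

lemma div_minus_swap:
  fixes a c :: int
  assumes "a \<noteq> 0 \<or> c \<noteq> 0" and "\<not> (a \<noteq> 0 \<and> (- c div a = 0 \<or> - c div a = - 1))"
  shows "c \<noteq> 0 \<and> (a div c = 0 \<or> a div c = - 1)"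
proof (cases "\<bar>a\<bar> < \<bar>c\<bar>")
  case True
  then show ?thesis using div_small by auto
next
  case False
  then have "a \<noteq> 0" using assms(1) by linarith
  have "\<not> \<bar>- c\<bar> < \<bar>a\<bar>" using assms(2) \<open>a \<noteq> 0\<close> div_small by blast
  with False have "c = a \<or> c = - a" by linarith
  moreover have "- a div a = - 1" "a div - a = - 1"
    using nonzero_mult_div_cancel_right [OF \<open>a \<noteq> 0\<close>, of "- 1"] by (simp_all add: div_minus_right)
  ultimately show ?thesis using assms(2) \<open>a \<noteq> 0\<close> by auto
qed

text \<open>The relations \<open>S\<^sup>4 = 1\<close> and \<open>S = T S T S T\<close> present \<open>SL\<^sub>2(\<int>)\<close>; here \<open>s \<gamma>\<close> is
  the effect of passing from \<open>\<gamma>\<close> to \<open>S \<gamma>\<close>, while \<open>T\<close> acts trivially.\<close>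

locale SL2Z_relations =
  fixes X :: "'x set" and s :: "int ^ 2 ^ 2 \<Rightarrow> 'x \<Rightarrow> 'x"
  assumes s_closed [simp]: "\<gamma> \<in> SL2Z \<Longrightarrow> x \<in> X \<Longrightarrow> s \<gamma> x \<in> X"
    and S4: "\<gamma> \<in> SL2Z \<Longrightarrow> x \<in> X \<Longrightarrow>
      s (- (S_mat ** \<gamma>)) (s (- \<gamma>) (s (S_mat ** \<gamma>) (s \<gamma> x))) = x"
    and STS: "\<gamma> \<in> SL2Z \<Longrightarrow> x \<in> X \<Longrightarrow>
      s (T_mat ** (S_mat ** (T_mat ** \<gamma>))) (s (T_mat ** \<gamma>) x) = s \<gamma> x"
begin

text \<open>The effect of passing from \<open>\<gamma>\<close> to \<open>- \<gamma>\<close>, since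
  S^2 = -1.\<close>

definition s2 :: "int ^ 2 ^ 2 \<Rightarrow> 'x \<Rightarrow> 'x" where
  "s2 \<gamma> x = s (S_mat ** \<gamma>) (s \<gamma> x)"

lemma s2_closed [simp]: "\<gamma> \<in> SL2Z \<Longrightarrow> x \<in> X \<Longrightarrow> s2 \<gamma> x \<in> X"
  by (simp add: s2_def)

lemma S_S: "S_mat ** (S_mat ** \<gamma>) = - \<gamma>" and S_uminus: "S_mat ** (- \<gamma>) = - (S_mat ** \<gamma>)"
  for \<gamma> :: "int ^ 2 ^ 2"
  by (cases \<gamma> rule: mat2_cases, simp add: S_mat_eq)+

lemma s2_s2: "\<gamma> \<in> SL2Z \<Longrightarrow> x \<in> X \<Longrightarrow> s2 (- \<gamma>) (s2 \<gamma> x) = x"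
  by (simp add: s2_def S_uminus S4)

text \<open>By \<open>S4\<close>, three further steps undo the first one.\<close>

lemma s_inj: "\<gamma> \<in> SL2Z \<Longrightarrow> x \<in> X \<Longrightarrow> y \<in> X \<Longrightarrow> s \<gamma> x = s \<gamma> y \<Longrightarrow> x = y"
  by (metis S4)

text \<open>S^2 is central, so its effect must not see \<open>T\<close>. The relation
  \<open>STS\<close> expands \<open>s \<gamma>\<close> at \<open>\<gamma>\<close>, and a second use
  at S T \<open>\<gamma>\<close> collapses the result.\<close>

lemma s2_T:
  assumes "\<gamma> \<in> SL2Z" "x \<in> X"
  shows "s2 (T_mat ** \<gamma>) x = s2 \<gamma> x"
proof -
  let ?\<eta> = "S_mat ** (T_mat ** \<gamma>)" and ?y = "s (T_mat ** \<gamma>) x"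
  have "s2 \<gamma> x = s (S_mat ** \<gamma>) (s (T_mat ** ?\<eta>) ?y)"
    using STS [OF assms] by (simp add: s2_def)
  also have "S_mat ** \<gamma> = T_mat ** (S_mat ** (T_mat ** ?\<eta>))"
    by (cases \<gamma> rule: mat2_cases) (simp add: S_mat_eq T_mat_eq)
  also have "s \<dots> (s (T_mat ** ?\<eta>) ?y) = s ?\<eta> ?y"
    using assms by (intro STS) auto
  finally show ?thesis by (simp add: s2_def)
qed

lemma s2_Tpow:
  assumes "\<gamma> \<in> SL2Z" "x \<in> X"
  shows "s2 (Tpow k ** \<gamma>) x = s2 \<gamma> x"
proof (rule Tpow_induct [of "\<lambda>\<gamma>'. s2 \<gamma>' x = s2 \<gamma> x"])
  fix k assume "s2 (Tpow k ** \<gamma>) x = s2 \<gamma> x"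
  then show "s2 (Tpow (k + 1) ** \<gamma>) x = s2 \<gamma> x"
    using assms s2_T [of "Tpow k ** \<gamma>" x] Tpow_add [of 1 k]
    by (simp add: Tpow_1 matrix_mul_assoc add.commute)
next
  fix k assume "s2 (Tpow k ** \<gamma>) x = s2 \<gamma> x"
  then show "s2 (Tpow (k - 1) ** \<gamma>) x = s2 \<gamma> x"
    using assms s2_T [of "Tpow (k - 1) ** \<gamma>" x] Tpow_add [of 1 "k - 1"]
    by (simp add: Tpow_1 matrix_mul_assoc)
qed simp

text \<open>The value that \<open>x\<close> at the identity acquires at \<open>\<gamma>\<close>.
  Powers of \<open>T\<close> cost nothing, so only the \<open>S\<close> of each Euclidean step is
  recorded. When \<open>c = 0\<close>, the lower right entry tells T^k from -T^k.\<close>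

function orbit :: "'x \<Rightarrow> int ^ 2 ^ 2 \<Rightarrow> 'x" where
  "orbit x \<gamma> = (if \<gamma> $ 2 $ 1 \<noteq> 0 then s (euclid_step \<gamma>) (orbit x (euclid_step \<gamma>))
     else if \<gamma> $ 2 $ 2 = 1 then x else s2 (mat 1) x)"
  by auto
termination
  by (relation "Wellfounded.measure (\<lambda>(_, \<gamma> :: int ^ 2 ^ 2). nat \<bar>\<gamma> $ 2 $ 1\<bar>)") (use euclid_step_less in \<open>auto simp: zero_less_abs_iff\<close>)

declare orbit.simps [simp del]

lemma orbit_step: "\<gamma> $ 2 $ 1 \<noteq> 0 \<Longrightarrow> orbit x \<gamma> = s (euclid_step \<gamma>) (orbit x (euclid_step \<gamma>))"
  by (subst orbit.simps) simp

lemma orbit_Tpow1: "orbit x (Tpow k) = x" and orbit_uminus_Tpow1: "orbit x (- Tpow k) = s2 (mat 1) x"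
  by (simp_all add: orbit.simps Tpow_def)

lemma orbit_Tpow: "orbit x (Tpow k ** \<gamma>) = orbit x \<gamma>"
proof (cases "\<gamma> $ 2 $ 1 = 0")
  case False
  moreover have "(Tpow k ** \<gamma>) $ 2 $ 1 = \<gamma> $ 2 $ 1"
    by (cases \<gamma> rule: mat2_cases) (simp add: Tpow_def)
  ultimately show ?thesis by (simp add: orbit_step euclid_step_Tpow)
next
  case True
  then show ?thesis by (cases \<gamma> rule: mat2_cases) (simp add: Tpow_def orbit.simps)
qed

lemma orbit_T: "orbit x (T_mat ** \<gamma>) = orbit x \<gamma>"
  using orbit_Tpow [of x 1] by (simp add: Tpow_1)

lemma orbit_closed [simp]: "\<gamma> \<in> SL2Z \<Longrightarrow> x \<in> X \<Longrightarrow> orbit x \<gamma> \<in> X"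
proof (induction "nat \<bar>\<gamma> $ 2 $ 1\<bar>" arbitrary: \<gamma> rule: less_induct)
  case less
  have "orbit x (euclid_step \<gamma>) \<in> X" if "\<gamma> $ 2 $ 1 \<noteq> 0"
    using less.prems euclid_step_less [OF that] by (intro less.hyps) auto
  then show ?case using less.prems by (subst orbit.simps) auto
qed

text \<open>Quotients do not change under negation, so the algorithm runs in parallel on
  \<open>\<gamma>\<close> and \<open>- \<gamma>\<close>, and the sign matters only at the end. There
  the definition of \<open>orbit\<close> or \<open>s2_s2\<close> applies.\<close>

lemma orbit_uminus: "\<gamma> \<in> SL2Z \<Longrightarrow> x \<in> X \<Longrightarrow> orbit x (- \<gamma>) = s2 \<gamma> (orbit x \<gamma>)"
proof (induction "nat \<bar>\<gamma> $ 2 $ 1\<bar>" arbitrary: \<gamma> rule: less_induct)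
  case less
  show ?case
  proof (cases "\<gamma> $ 2 $ 1 = 0")
    case True
    have s2k: "s2 (Tpow k) y = s2 (mat 1) y" "s2 (- Tpow k) y = s2 (- mat 1) y" if "y \<in> X" for k y
      using s2_Tpow [of "mat 1" y k] s2_Tpow [of "- mat 1" y k] that
      by (simp_all add: Tpow_def mat2_one)
    show ?thesis using less.prems(1) True
    proof (cases rule: SL2Z_cases_c0)
      case (1 k)
      then show ?thesis using less.prems by (simp add: orbit_Tpow1 orbit_uminus_Tpow1 s2k)
    next
      case (2 k)
      then show ?thesis using less.prems by (simp add: orbit_Tpow1 orbit_uminus_Tpow1 s2k s2_s2)
    qed
  next
    case False
    let ?\<gamma>' = "euclid_step \<gamma>" and ?k = "\<gamma> $ 1 $ 1 div \<gamma> $ 2 $ 1"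
    have IH: "orbit x (- ?\<gamma>') = s2 ?\<gamma>' (orbit x ?\<gamma>')"
      using less.prems euclid_step_less [OF False] False by (intro less.hyps) auto
    have "orbit x (- \<gamma>) = s (- ?\<gamma>') (s2 ?\<gamma>' (orbit x ?\<gamma>'))"
      using False IH by (subst orbit_step) (auto simp: euclid_step_uminus)
    \<comment> \<open>Three steps by S are regrouped: S after S^2 is S^2 after S.\<close>
    also have "\<dots> = s2 (S_mat ** ?\<gamma>') (orbit x \<gamma>)"
      using False by (simp add: orbit_step [of \<gamma>] s2_def S_S)
    also have "\<dots> = s2 (Tpow ?k ** (S_mat ** ?\<gamma>')) (orbit x \<gamma>)"
      using less.prems by (simp add: s2_Tpow)
    finally show ?thesis using euclid_step_eq [of \<gamma>] by simp
  qed
qed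

text \<open>Passing to S \<open>\<gamma>\<close> may change the sequence of quotients. For quotient
  0 the first Euclidean step just returns to \<open>\<gamma>\<close>; for quotient -1 the relation
  \<open>STS\<close> leads through a smaller matrix; in all other cases the claim holds for S
  \<open>\<gamma>\<close> and is carried back to \<open>\<gamma>\<close>.\<close>

lemma orbit_S: "\<gamma> \<in> SL2Z \<Longrightarrow> x \<in> X \<Longrightarrow> orbit x (S_mat ** \<gamma>) = s \<gamma> (orbit x \<gamma>)"
proof (induction "nat (\<bar>\<gamma> $ 1 $ 1\<bar> + \<bar>\<gamma> $ 2 $ 1\<bar>)" arbitrary: \<gamma> rule: less_induct)
  case less
  define n where "n = nat (\<bar>\<gamma> $ 1 $ 1\<bar> + \<bar>\<gamma> $ 2 $ 1\<bar>)"
  have IH: "orbit x (S_mat ** \<epsilon>) = s \<epsilon> (orbit x \<epsilon>)"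
    if "\<epsilon> \<in> SL2Z" "nat (\<bar>\<epsilon> $ 1 $ 1\<bar> + \<bar>\<epsilon> $ 2 $ 1\<bar>) < n" for \<epsilon>
    using less.hyps that less.prems by (simp add: n_def)
  \<comment> \<open>Stated for every matrix of measure \<open>n\<close>, because it is also applied
    to \<open>S_mat ** \<gamma>\<close>, whose first column has the same measure.\<close>
  have step: "orbit x (S_mat ** \<gamma>) = s \<gamma> (orbit x \<gamma>)"
    if \<gamma>: "\<gamma> \<in> SL2Z" "nat (\<bar>\<gamma> $ 1 $ 1\<bar> + \<bar>\<gamma> $ 2 $ 1\<bar>) = n"
      and a: "\<gamma> $ 1 $ 1 \<noteq> 0"
      and k: "- (\<gamma> $ 2 $ 1) div \<gamma> $ 1 $ 1 = 0 \<or> - (\<gamma> $ 2 $ 1) div \<gamma> $ 1 $ 1 = - 1" for \<gamma>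
  proof (cases \<gamma> rule: mat2_cases)
    case (mat2 a b c d)
    have "(S_mat ** \<gamma>) $ 2 $ 1 \<noteq> 0" using a by (simp add: mat2 S_mat_eq)
    note step = orbit_step [OF this]
    from k consider "(- c) div a = 0" | "(- c) div a = - 1" by (auto simp: mat2)
    then show ?thesis
    proof cases
      case 1
      then have "euclid_step (S_mat ** \<gamma>) = \<gamma>"
        by (simp add: mat2 S_mat_eq euclid_step_def minus_div_mult_eq_mod [symmetric])
      then show ?thesis using step by simp
    next
      case 2
      \<comment> \<open>\<open>\<epsilon>\<close> is (TS)^-1 \<open>\<gamma>\<close>. As
        \<open>c\<close> lies strictly on the side of \<open>a\<close> and not beyond it, the
        measure of \<open>\<epsilon>\<close> is |c| + |c - a| = |a|, less than |a| + |c|.\<close>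
      define \<epsilon> where "\<epsilon> = mat2 c d (c - a) (d - b)"
      define \<rho> where "\<rho> = mat2 a b (c - a) (d - b)"
      have \<rho>: "\<rho> = euclid_step (S_mat ** \<gamma>)"
        using 2 by (simp add: \<rho>_def mat2 S_mat_eq euclid_step_def minus_div_mult_eq_mod [symmetric])
      have SL: "\<epsilon> \<in> SL2Z" "\<rho> \<in> SL2Z"
        using \<gamma> by (simp_all add: \<epsilon>_def \<rho>_def mat2 algebra_simps)
      have eqs: "\<epsilon> = T_mat ** \<rho>" "\<gamma> = T_mat ** (S_mat ** (T_mat ** \<rho>))" "\<gamma> = T_mat ** (S_mat ** \<epsilon>)"
        by (simp_all add: \<epsilon>_def \<rho>_def mat2 S_mat_eq T_mat_eq)
      have "0 < c \<and> c \<le> a \<or> c < 0 \<and> a \<le> c"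
        using div_eq_minus_one [OF _ 2] a by (simp add: mat2)
      then have "nat (\<bar>\<epsilon> $ 1 $ 1\<bar> + \<bar>\<epsilon> $ 2 $ 1\<bar>) < n"
        using \<gamma>(2) by (auto simp: \<epsilon>_def mat2)
      then have "orbit x (S_mat ** \<epsilon>) = s \<epsilon> (orbit x \<epsilon>)" by (intro IH SL)
      then have "orbit x \<gamma> = s (T_mat ** \<rho>) (orbit x \<rho>)"
        using eqs by (metis orbit_T)
      then have "s \<gamma> (orbit x \<gamma>) = s \<rho> (orbit x \<rho>)"
        using STS [of \<rho> "orbit x \<rho>"] SL less.prems eqs(2) by simp
      then show ?thesis using step \<rho> by simp
    qed
  qed
  let ?a = "\<gamma> $ 1 $ 1" and ?c = "\<gamma> $ 2 $ 1"
  show ?case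
  proof (cases "?a \<noteq> 0 \<and> (- ?c div ?a = 0 \<or> - ?c div ?a = - 1)")
    case True
    then show ?thesis using step [of \<gamma>] less.prems n_def by auto
  next
    case False
    have *: "(S_mat ** \<gamma>) $ 1 $ 1 = - ?c" "(S_mat ** \<gamma>) $ 2 $ 1 = ?a"
      by (cases \<gamma> rule: mat2_cases; simp add: S_mat_eq)+
    have "?a \<noteq> 0 \<or> ?c \<noteq> 0"
      using less.prems(1) by (cases \<gamma> rule: mat2_cases) auto
    then have "?c \<noteq> 0 \<and> (?a div ?c = 0 \<or> ?a div ?c = - 1)"
      using False by (rule div_minus_swap)
    \<comment> \<open>Now S \<open>\<gamma>\<close> has quotient 0 or -1. Both this equation and
      \<open>orbit_uminus\<close> compute the value at \<open>- \<gamma>\<close>, and cancelling the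
      outer step yields the claim for \<open>\<gamma>\<close>.\<close>
    then have "orbit x (S_mat ** (S_mat ** \<gamma>)) = s (S_mat ** \<gamma>) (orbit x (S_mat ** \<gamma>))"
      using less.prems(1) by (intro step) (auto simp: * n_def)
    moreover have "orbit x (- \<gamma>) = s (S_mat ** \<gamma>) (s \<gamma> (orbit x \<gamma>))"
      using orbit_uminus [OF less.prems] by (simp add: s2_def)
    ultimately have "s (S_mat ** \<gamma>) (orbit x (S_mat ** \<gamma>)) = s (S_mat ** \<gamma>) (s \<gamma> (orbit x \<gamma>))"
      by (simp only: S_S)
    then show ?thesis
      by (rule s_inj [rotated -1]) (simp_all add: less.prems)
  qed
qed

end

section \<open>Meromorphic functions of two variables\<close>

text \<open>For open \<open>D\<close>, a property is eventually true when it holds on an open set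
  dense in \<open>D\<close>. As a filter, this notion lets \<open>eventually_elim\<close> combine
  identities of meromorphic functions.\<close>

definition generic :: "(complex \<times> complex) set \<Rightarrow> (complex \<times> complex) filter" where
  "generic D = Abs_filter (\<lambda>P. \<forall>V. open V \<and> V \<noteq> {} \<and> V \<subseteq> D \<longrightarrow>
     (\<exists>V'. open V' \<and> V' \<noteq> {} \<and> V' \<subseteq> V \<and> (\<forall>p\<in>V'. P p)))"

lemma eventually_generic:
  "eventually P (generic D) \<longleftrightarrow> (\<forall>V. open V \<and> V \<noteq> {} \<and> V \<subseteq> D \<longrightarrow>
     (\<exists>V'. open V' \<and> V' \<noteq> {} \<and> V' \<subseteq> V \<and> (\<forall>p\<in>V'. P p)))"
  unfolding generic_def
proof (rule eventually_Abs_filter, rule is_filter.intro)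
  show "\<forall>V. open V \<and> V \<noteq> {} \<and> V \<subseteq> D \<longrightarrow>
     (\<exists>V'. open V' \<and> V' \<noteq> {} \<and> V' \<subseteq> V \<and> (\<forall>p\<in>V'. True))"
    by (metis subset_refl)
next
  fix P Q :: "complex \<times> complex \<Rightarrow> bool"
  let ?G = "\<lambda>P. \<forall>V. open V \<and> V \<noteq> {} \<and> V \<subseteq> D \<longrightarrow>
     (\<exists>V'. open V' \<and> V' \<noteq> {} \<and> V' \<subseteq> V \<and> (\<forall>p\<in>V'. P p))"
  assume P: "?G P" and Q: "?G Q"
  show "?G (\<lambda>x. P x \<and> Q x)"
  proof (intro allI impI)
    fix V assume V: "open V \<and> V \<noteq> {} \<and> V \<subseteq> D"
    from P [rule_format, OF V] obtain V1 where
      V1: "open V1" "V1 \<noteq> {}" "V1 \<subseteq> V" "\<forall>p\<in>V1. P p" by (elim exE conjE)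
    have "open V1 \<and> V1 \<noteq> {} \<and> V1 \<subseteq> D"
      using V V1 by auto
    from Q [rule_format, OF this] obtain V2 where
      "open V2" "V2 \<noteq> {}" "V2 \<subseteq> V1" "\<forall>p\<in>V2. Q p" by (elim exE conjE)
    then show "\<exists>V'. open V' \<and> V' \<noteq> {} \<and> V' \<subseteq> V \<and> (\<forall>p\<in>V'. P p \<and> Q p)"
      using V1 by (intro exI [of _ V2]) auto
  qed
next
  fix P Q :: "complex \<times> complex \<Rightarrow> bool"
  assume imp: "\<forall>x. P x \<longrightarrow> Q x" and P: "\<forall>V. open V \<and> V \<noteq> {} \<and> V \<subseteq> D \<longrightarrow>
     (\<exists>V'. open V' \<and> V' \<noteq> {} \<and> V' \<subseteq> V \<and> (\<forall>p\<in>V'. P p))"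
  show "\<forall>V. open V \<and> V \<noteq> {} \<and> V \<subseteq> D \<longrightarrow>
     (\<exists>V'. open V' \<and> V' \<noteq> {} \<and> V' \<subseteq> V \<and> (\<forall>p\<in>V'. Q p))"
  proof (intro allI impI)
    fix V assume V: "open V \<and> V \<noteq> {} \<and> V \<subseteq> D"
    from P [rule_format, OF V] obtain V' where
      "open V'" "V' \<noteq> {}" "V' \<subseteq> V" "\<forall>p\<in>V'. P p" by (elim exE conjE)
    then show "\<exists>V'. open V' \<and> V' \<noteq> {} \<and> V' \<subseteq> V \<and> (\<forall>p\<in>V'. Q p)"
      by (intro exI [of _ V'] conjI ballI imp [rule_format]) auto
  qed
qed

lemma eventually_genericE:
  assumes "eventually P (generic D)" "open V" "V \<noteq> {}" "V \<subseteq> D"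
  obtains V' where "open V'" "V' \<noteq> {}" "V' \<subseteq> V" "\<forall>p\<in>V'. P p"
  using assms unfolding eventually_generic by (metis (no_types))

lemma eventually_genericI:
  assumes "\<And>V. open V \<Longrightarrow> V \<noteq> {} \<Longrightarrow> V \<subseteq> D \<Longrightarrow> \<exists>V'. open V' \<and> V' \<noteq> {} \<and> V' \<subseteq> V \<and> (\<forall>p\<in>V'. P p)"
  shows "eventually P (generic D)"
  using assms unfolding eventually_generic by (intro allI impI) (elim conjE)

lemma mero_eq_generic:
  assumes "open D"
  shows "mero_eq D f g \<longleftrightarrow> eventually (\<lambda>p. f p = g p) (generic D)"
proof
  let ?I = "interior {p \<in> D. f p = g p}"
  assume L: "mero_eq D f g"
  show "eventually (\<lambda>p. f p = g p) (generic D)"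
  proof (rule eventually_genericI)
    fix V assume V: "open V" "V \<noteq> {}" "V \<subseteq> D"
    then have "V \<inter> closure ?I \<noteq> {}" using L by (auto simp: mero_eq_def)
    then have "V \<inter> ?I \<noteq> {}" using V(1) by (simp add: open_Int_closure_eq_empty)
    then show "\<exists>V'. open V' \<and> V' \<noteq> {} \<and> V' \<subseteq> V \<and> (\<forall>p\<in>V'. f p = g p)"
      using V(1) interior_subset [of "{p \<in> D. f p = g p}"]
      by (intro exI [of _ "V \<inter> ?I"]) (auto simp: open_Int)
  qed
next
  let ?I = "interior {p \<in> D. f p = g p}"
  assume R: "eventually (\<lambda>p. f p = g p) (generic D)"
  show "mero_eq D f g"
    unfolding mero_eq_def
  proof
    fix p assume p: "p \<in> D"
    show "p \<in> closure ?I"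
      unfolding closure_iff_nhds_not_empty
    proof (intro allI impI)
      fix A U assume U: "U \<subseteq> A" "p \<in> U" "open U"
      have UD: "open (U \<inter> D)" "U \<inter> D \<noteq> {}" "U \<inter> D \<subseteq> D"
        using p U assms by auto
      obtain V' where
        V': "open V'" "V' \<noteq> {}" "V' \<subseteq> U \<inter> D" "\<forall>p\<in>V'. f p = g p"
      by (rule eventually_genericE [OF R UD])
      then have "V' \<subseteq> ?I" by (intro interior_maximal) auto
      moreover have "V' \<subseteq> A" using V'(3) U(1) by auto
      ultimately have "V' \<subseteq> ?I \<inter> A" by (rule Int_greatest)
      then show "?I \<inter> A \<noteq> {}" using V'(2) by force
    qed
  qed
qed

text \<open>A nonempty open subset of \<open>E\<close> must meet the dense set \<open>D\<close>.
  This carries generic properties of \<open>dom0\<close> to domains containing real points.\<close>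

lemma generic_dense_subset:
  assumes "open D" "E \<subseteq> closure D" "eventually P (generic D)"
  shows "eventually P (generic E)"
proof (rule eventually_genericI)
  fix V assume V: "open V" "V \<noteq> {}" "V \<subseteq> E"
  then have "V \<inter> closure D \<noteq> {}" using assms(2) by auto
  then have VD: "open (V \<inter> D)" "V \<inter> D \<noteq> {}" "V \<inter> D \<subseteq> D"
    using V assms(1) by (auto simp: open_Int_closure_eq_empty)
  from eventually_genericE [OF assms(3) this] obtain V' where
    "open V'" "V' \<noteq> {}" "V' \<subseteq> V \<inter> D" "\<forall>p\<in>V'. P p"
      by blast
  then show "\<exists>V'. open V' \<and> V' \<noteq> {} \<and> V' \<subseteq> V \<and> (\<forall>p\<in>V'. P p)"
    by (intro exI [of _ V']) simp
qed

lemma generic_subset: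
  assumes "D \<subseteq> E" "eventually P (generic E)"
  shows "eventually P (generic D)"
proof (rule eventually_genericI)
  fix V assume "open V" "V \<noteq> {}" "V \<subseteq> D"
  then have "open V" "V \<noteq> {}" "V \<subseteq> E" using assms(1) by auto
  from eventually_genericE [OF assms(2) this] obtain V' where
    "open V'" "V' \<noteq> {}" "V' \<subseteq> V" "\<forall>p\<in>V'. P p"
    by blast
  then show "\<exists>V'. open V' \<and> V' \<noteq> {} \<and> V' \<subseteq> V \<and> (\<forall>p\<in>V'. P p)"
    by (intro exI [of _ V']) simp
qed

lemma eventually_generic_mem: "eventually (\<lambda>p. p \<in> D) (generic D)"
proof (rule eventually_genericI)
  fix V assume "open V" "V \<noteq> {}" "V \<subseteq> D"
  then show "\<exists>V'. open V' \<and> V' \<noteq> {} \<and> V' \<subseteq> V \<and> (\<forall>p\<in>V'. p \<in> D)"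
    by (intro exI [of _ V]) auto
qed

lemma eventually_generic_frequently:
  assumes "eventually P (generic D)" "open V" "V \<noteq> {}" "V \<subseteq> D"
  shows "\<exists>p\<in>V. P p"
proof -
  obtain V' where
    "V' \<noteq> {}" "V' \<subseteq> V" "\<forall>p\<in>V'. P p"
      by (rule eventually_genericE [OF assms])
  then show ?thesis by auto
qed

text \<open>A test set is pushed forward, shrunk in the target and pulled back. Openness of the map
  makes the first move legitimate, continuity the last.\<close>

lemma generic_vimage:
  assumes P: "eventually P (generic E)"
    and img: "\<And>V. open V \<Longrightarrow> V \<subseteq> D \<Longrightarrow> open (\<phi> ` V)"
    and cont: "continuous_on D \<phi>" and "open D" and sub: "\<phi> ` D \<subseteq> E"
  shows "eventually (\<lambda>p. P (\<phi> p)) (generic D)"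
proof (rule eventually_genericI)
  fix V assume V: "open V" "V \<noteq> {}" "V \<subseteq> D"
  then have "open (\<phi> ` V)" "\<phi> ` V \<noteq> {}" "\<phi> ` V \<subseteq> E" using img sub by auto
  from eventually_genericE [OF P this] obtain V' where
    V': "open V'" "V' \<noteq> {}" "V' \<subseteq> \<phi> ` V" "\<forall>p\<in>V'. P p"
      by blast
  have "open (V \<inter> \<phi> -` V')"
    by (intro continuous_open_preimage continuous_on_subset [OF cont] V V')
  moreover obtain q where "q \<in> V'" using V'(2) by blast
  with V'(3) obtain p where "p \<in> V" "q = \<phi> p" by (metis imageE subsetD)
  then have "V \<inter> \<phi> -` V' \<noteq> {}" using \<open>q \<in> V'\<close> by (metis IntI empty_iff vimageI)
  ultimately show "\<exists>V'. open V' \<and> V' \<noteq> {} \<and> V' \<subseteq> V \<and> (\<forall>p\<in>V'. P (\<phi> p))"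
    using V'(4) by (intro exI [of _ "V \<inter> \<phi> -` V'"]) simp
qed

section \<open>Holomorphic functions of two variables\<close>

lemma holomorphic2_on_subset: "holomorphic2_on f W \<Longrightarrow> W' \<subseteq> W \<Longrightarrow> holomorphic2_on f W'"
  by (auto simp: holomorphic2_on_def)

lemma holomorphic2_onI:
  assumes "\<And>p. p \<in> W \<Longrightarrow> (f has_derivative (\<lambda>v. a p * fst v + b p * snd v)) (at p)"
  shows "holomorphic2_on f W"
  using assms unfolding holomorphic2_on_def case_prod_unfold by blast

lemma holomorphic2_onE:
  assumes "holomorphic2_on f W" 
  obtains a b where "\<And>p. p \<in> W \<Longrightarrow> (f has_derivative (\<lambda>v. a p * fst v + b p * snd v)) (at p)"
  using assms unfolding holomorphic2_on_def case_prod_unfold by metis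

lemma holomorphic2_on_continuous: "holomorphic2_on f W \<Longrightarrow> continuous_on W f"
  by (elim holomorphic2_onE)
    (blast intro: continuous_at_imp_continuous_on has_derivative_continuous)

lemma holomorphic2_on_const: "holomorphic2_on (\<lambda>_. c) W"
  by (rule holomorphic2_onI [where a = "\<lambda>_. 0" and b = "\<lambda>_. 0"]) (auto intro: has_derivative_const)

lemma holomorphic2_on_fst: "holomorphic2_on fst W"
  by (rule holomorphic2_onI [where a = "\<lambda>_. 1" and b = "\<lambda>_. 0"]) (auto intro!: derivative_eq_intros)

lemma holomorphic2_on_snd: "holomorphic2_on snd W"
  by (rule holomorphic2_onI [where a = "\<lambda>_. 0" and b = "\<lambda>_. 1"]) (auto intro!: derivative_eq_intros)

lemma holomorphic2_on_add:
  assumes "holomorphic2_on f W" "holomorphic2_on g W"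
  shows "holomorphic2_on (\<lambda>p. f p + g p) W"
proof -
  from assms obtain a b a' b' where "\<And>p. p \<in> W \<Longrightarrow> (f has_derivative (\<lambda>v. a p * fst v + b p * snd v)) (at p)"
    "\<And>p. p \<in> W \<Longrightarrow> (g has_derivative (\<lambda>v. a' p * fst v + b' p * snd v)) (at p)"
    by (elim holomorphic2_onE) blast
  then show ?thesis
    by (intro holomorphic2_onI [where a = "\<lambda>p. a p + a' p" and b = "\<lambda>p. b p + b' p"])
      (auto intro!: derivative_eq_intros simp: algebra_simps fun_eq_iff)
qed

lemma holomorphic2_on_mult:
  assumes "holomorphic2_on f W" "holomorphic2_on g W"
  shows "holomorphic2_on (\<lambda>p. f p * g p) W"
proof -
  from assms obtain a b a' b' where "\<And>p. p \<in> W \<Longrightarrow> (f has_derivative (\<lambda>v. a p * fst v + b p * snd v)) (at p)"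
    "\<And>p. p \<in> W \<Longrightarrow> (g has_derivative (\<lambda>v. a' p * fst v + b' p * snd v)) (at p)"
    by (elim holomorphic2_onE) blast
  then show ?thesis
    by (intro holomorphic2_onI [where a = "\<lambda>p. f p * a' p + a p * g p" and b = "\<lambda>p. f p * b' p + b p * g p"])
      (auto intro!: derivative_eq_intros simp: algebra_simps fun_eq_iff)
qed

lemma holomorphic2_on_divide:
  assumes "holomorphic2_on f W" "holomorphic2_on g W" "\<And>p. p \<in> W \<Longrightarrow> g p \<noteq> 0"
  shows "holomorphic2_on (\<lambda>p. f p / g p) W"
proof -
  from assms obtain a b a' b' where "\<And>p. p \<in> W \<Longrightarrow> (f has_derivative (\<lambda>v. a p * fst v + b p * snd v)) (at p)"
    "\<And>p. p \<in> W \<Longrightarrow> (g has_derivative (\<lambda>v. a' p * fst v + b' p * snd v)) (at p)"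
    by (elim holomorphic2_onE) blast
  then show ?thesis using assms(3)
    by (intro holomorphic2_onI [where a = "\<lambda>p. (a p * g p - f p * a' p) / (g p * g p)"
          and b = "\<lambda>p. (b p * g p - f p * b' p) / (g p * g p)"])
      (auto intro!: derivative_eq_intros simp: field_simps fun_eq_iff)
qed

lemma holomorphic2_on_compose:
  assumes f: "holomorphic2_on f W" and 1: "holomorphic2_on (\<lambda>p. fst (\<phi> p)) W'"
    and 2: "holomorphic2_on (\<lambda>p. snd (\<phi> p)) W'" and sub: "\<phi> ` W' \<subseteq> W"
  shows "holomorphic2_on (\<lambda>p. f (\<phi> p)) W'"
proof -
  from f obtain a b where f: "\<And>p. p \<in> W \<Longrightarrow> (f has_derivative (\<lambda>v. a p * fst v + b p * snd v)) (at p)"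
    by (elim holomorphic2_onE) blast
  from 1 2 obtain a1 b1 a2 b2 where
    "\<And>p. p \<in> W' \<Longrightarrow> ((\<lambda>p. fst (\<phi> p)) has_derivative (\<lambda>v. a1 p * fst v + b1 p * snd v)) (at p)"
    "\<And>p. p \<in> W' \<Longrightarrow> ((\<lambda>p. snd (\<phi> p)) has_derivative (\<lambda>v. a2 p * fst v + b2 p * snd v)) (at p)"
    by (elim holomorphic2_onE) blast
  then have \<phi>: "(\<phi> has_derivative (\<lambda>v. (a1 p * fst v + b1 p * snd v, a2 p * fst v + b2 p * snd v))) (at p)"
    if "p \<in> W'" for p
    using has_derivative_Pair that by fastforce
  show ?thesis
  proof (rule holomorphic2_onI)
    fix p assume "p \<in> W'"
    then show "((\<lambda>p. f (\<phi> p)) has_derivative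
       (\<lambda>v. (a (\<phi> p) * a1 p + b (\<phi> p) * a2 p) * fst v + (a (\<phi> p) * b1 p + b (\<phi> p) * b2 p) * snd v)) (at p)"
      using sub by (intro has_derivative_eq_rhs [OF has_derivative_compose [OF \<phi> f]])
        (auto simp: algebra_simps fun_eq_iff)
  qed
qed

text \<open>By continuity, one nonzero value spreads to an open set, so the condition on
  denominators in \<open>meromorphic2_on\<close> becomes a filter statement.\<close>

lemma generic_nonzero:
  assumes "holomorphic2_on h W" "open W"
  shows "eventually (\<lambda>p. h p \<noteq> 0) (generic W) \<longleftrightarrow>
    (\<forall>V. open V \<and> V \<noteq> {} \<and> V \<subseteq> W \<longrightarrow> (\<exists>x\<in>V. h x \<noteq> 0))"
proof
  assume R: "\<forall>V. open V \<and> V \<noteq> {} \<and> V \<subseteq> W \<longrightarrow> (\<exists>x\<in>V. h x \<noteq> 0)"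
  show "eventually (\<lambda>p. h p \<noteq> 0) (generic W)"
  proof (rule eventually_genericI)
    fix V assume V: "open V" "V \<noteq> {}" "V \<subseteq> W"
    then have "open (V \<inter> h -` (- {0}))"
      by (intro continuous_open_preimage continuous_on_subset [OF holomorphic2_on_continuous [OF assms(1)]]) auto
    moreover have "\<exists>x\<in>V. h x \<noteq> 0" using R V by simp
    then obtain x where "x \<in> V" "h x \<noteq> 0" by (rule bexE)
    then have "x \<in> V \<inter> h -` (- {0})" by simp
    then have "V \<inter> h -` (- {0}) \<noteq> {}" by (metis empty_iff)
    ultimately show "\<exists>V'. open V' \<and> V' \<noteq> {} \<and> V' \<subseteq> V \<and> (\<forall>p\<in>V'. h p \<noteq> 0)"
      by (intro exI [of _ "V \<inter> h -` (- {0})"]) simp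
  qed
next
  assume "eventually (\<lambda>p. h p \<noteq> 0) (generic W)"
  then show "\<forall>V. open V \<and> V \<noteq> {} \<and> V \<subseteq> W \<longrightarrow> (\<exists>x\<in>V. h x \<noteq> 0)"
    by (intro allI impI) (elim conjE, rule eventually_generic_frequently)
qed

section \<open>Closure properties of meromorphic functions\<close>

lemma meromorphic2_on_iff:
  "meromorphic2_on f D \<longleftrightarrow>
     (\<forall>p\<in>D. \<exists>W g h. open W \<and> p \<in> W \<and> holomorphic2_on g W \<and> holomorphic2_on h W \<and>
        eventually (\<lambda>p. h p \<noteq> 0) (generic W) \<and> (\<forall>x\<in>W. h x \<noteq> 0 \<longrightarrow> f x = g x / h x))"
proof -
  have "(open W \<and> p \<in> W \<and> holomorphic2_on g W \<and> holomorphic2_on h W \<and>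
        (\<forall>V. open V \<and> V \<noteq> {} \<and> V \<subseteq> W \<longrightarrow> (\<exists>x\<in>V. h x \<noteq> 0)) \<and> R) =
      (open W \<and> p \<in> W \<and> holomorphic2_on g W \<and> holomorphic2_on h W \<and>
        eventually (\<lambda>p. h p \<noteq> 0) (generic W) \<and> R)" for W p g h R
    by (intro conj_cong refl) (simp add: generic_nonzero)
  then show ?thesis unfolding meromorphic2_on_def by (simp only:)
qed

lemma meromorphic2_onE:
  assumes "meromorphic2_on f D" "p \<in> D"
  obtains W g h where "open W" "p \<in> W" "holomorphic2_on g W" "holomorphic2_on h W"
    "eventually (\<lambda>p. h p \<noteq> 0) (generic W)" "\<forall>x\<in>W. h x \<noteq> 0 \<longrightarrow> f x = g x / h x"
proof -
  from assms have "\<exists>W g h. open W \<and> p \<in> W \<and> holomorphic2_on g W \<and> holomorphic2_on h W \<and>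
        eventually (\<lambda>p. h p \<noteq> 0) (generic W) \<and> (\<forall>x\<in>W. h x \<noteq> 0 \<longrightarrow> f x = g x / h x)"
    unfolding meromorphic2_on_iff by (rule bspec)
  then show thesis by (elim exE conjE) (rule that)
qed

lemma meromorphic2_on_subset: "meromorphic2_on f E \<Longrightarrow> D \<subseteq> E \<Longrightarrow> meromorphic2_on f D"
  unfolding meromorphic2_on_def by blast

lemma meromorphic2_on_const: "meromorphic2_on (\<lambda>_. c) D"
  unfolding meromorphic2_on_iff
  by (intro ballI exI [of _ UNIV] exI [of _ "\<lambda>_. c"] exI [of _ "\<lambda>_. 1"])
    (auto intro: holomorphic2_on_const)

lemma meromorphic2_on_common:
  assumes "meromorphic2_on f D" "meromorphic2_on f' D" "p \<in> D"
  obtains W g h g' h' where "open W" "p \<in> W"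
    "holomorphic2_on g W" "holomorphic2_on h W" "holomorphic2_on g' W" "holomorphic2_on h' W"
    "eventually (\<lambda>p. h p \<noteq> 0 \<and> h' p \<noteq> 0) (generic W)"
    "\<forall>x\<in>W. h x \<noteq> 0 \<longrightarrow> f x = g x / h x" "\<forall>x\<in>W. h' x \<noteq> 0 \<longrightarrow> f' x = g' x / h' x"
proof -
  obtain W g h where 1: "open W" "p \<in> W" "holomorphic2_on g W" "holomorphic2_on h W"
    "eventually (\<lambda>p. h p \<noteq> 0) (generic W)" "\<forall>x\<in>W. h x \<noteq> 0 \<longrightarrow> f x = g x / h x"
    by (rule meromorphic2_onE [OF assms(1,3)])
  obtain W' g' h' where 2: "open W'" "p \<in> W'" "holomorphic2_on g' W'" "holomorphic2_on h' W'"
    "eventually (\<lambda>p. h' p \<noteq> 0) (generic W')" "\<forall>x\<in>W'. h' x \<noteq> 0 \<longrightarrow> f' x = g' x / h' x"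
    by (rule meromorphic2_onE [OF assms(2,3)])
  show ?thesis
  proof (rule that [of "W \<inter> W'" g h g' h'])
    show "eventually (\<lambda>p. h p \<noteq> 0 \<and> h' p \<noteq> 0) (generic (W \<inter> W'))"
      using generic_subset [OF Int_lower1 1(5)] generic_subset [OF Int_lower2 2(5)]
      by (rule eventually_conj)
    show "holomorphic2_on g (W \<inter> W')" "holomorphic2_on h (W \<inter> W')"
      "holomorphic2_on g' (W \<inter> W')" "holomorphic2_on h' (W \<inter> W')"
      by (rule holomorphic2_on_subset, fact, simp)+
  qed (use 1 2 in \<open>simp_all add: open_Int\<close>)
qed

lemma meromorphic2_on_add:
  assumes "meromorphic2_on f D" "meromorphic2_on f' D"
  shows "meromorphic2_on (\<lambda>p. f p + f' p) D"
  unfolding meromorphic2_on_iff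
proof
  fix p assume "p \<in> D"
  obtain W g h g' h' where *: "open W" "p \<in> W"
    "holomorphic2_on g W" "holomorphic2_on h W" "holomorphic2_on g' W" "holomorphic2_on h' W"
    "eventually (\<lambda>p. h p \<noteq> 0 \<and> h' p \<noteq> 0) (generic W)"
    "\<forall>x\<in>W. h x \<noteq> 0 \<longrightarrow> f x = g x / h x" "\<forall>x\<in>W. h' x \<noteq> 0 \<longrightarrow> f' x = g' x / h' x"
    by (rule meromorphic2_on_common [OF assms \<open>p \<in> D\<close>])
  show "\<exists>W g h. open W \<and> p \<in> W \<and> holomorphic2_on g W \<and> holomorphic2_on h W \<and>
     eventually (\<lambda>p. h p \<noteq> 0) (generic W) \<and> (\<forall>x\<in>W. h x \<noteq> 0 \<longrightarrow> f x + f' x = g x / h x)"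
  proof (intro exI conjI)
    show "holomorphic2_on (\<lambda>p. g p * h' p + g' p * h p) W" "holomorphic2_on (\<lambda>p. h p * h' p) W"
      by (intro holomorphic2_on_add holomorphic2_on_mult *)+
    show "\<forall>x\<in>W. h x * h' x \<noteq> 0 \<longrightarrow> f x + f' x = (g x * h' x + g' x * h x) / (h x * h' x)"
      using *(8,9) by (simp add: add_frac_eq)
  qed (use * in simp_all)
qed

lemma meromorphic2_on_mult:
  assumes "meromorphic2_on f D" "meromorphic2_on f' D"
  shows "meromorphic2_on (\<lambda>p. f p * f' p) D"
  unfolding meromorphic2_on_iff
proof
  fix p assume "p \<in> D"
  obtain W g h g' h' where *: "open W" "p \<in> W"
    "holomorphic2_on g W" "holomorphic2_on h W" "holomorphic2_on g' W" "holomorphic2_on h' W"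
    "eventually (\<lambda>p. h p \<noteq> 0 \<and> h' p \<noteq> 0) (generic W)"
    "\<forall>x\<in>W. h x \<noteq> 0 \<longrightarrow> f x = g x / h x" "\<forall>x\<in>W. h' x \<noteq> 0 \<longrightarrow> f' x = g' x / h' x"
    by (rule meromorphic2_on_common [OF assms \<open>p \<in> D\<close>])
  show "\<exists>W g h. open W \<and> p \<in> W \<and> holomorphic2_on g W \<and> holomorphic2_on h W \<and>
     eventually (\<lambda>p. h p \<noteq> 0) (generic W) \<and> (\<forall>x\<in>W. h x \<noteq> 0 \<longrightarrow> f x * f' x = g x / h x)"
  proof (intro exI conjI)
    show "holomorphic2_on (\<lambda>p. g p * g' p) W" "holomorphic2_on (\<lambda>p. h p * h' p) W"
      by (intro holomorphic2_on_mult *)+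
    show "\<forall>x\<in>W. h x * h' x \<noteq> 0 \<longrightarrow> f x * f' x = (g x * g' x) / (h x * h' x)"
      using *(8,9) by simp
  qed (use * in simp_all)
qed

lemma meromorphic2_on_inverse:
  assumes "meromorphic2_on f D" "open D" "eventually (\<lambda>p. f p \<noteq> 0) (generic D)"
  shows "meromorphic2_on (\<lambda>p. inverse (f p)) D"
  unfolding meromorphic2_on_iff
proof
  fix p assume "p \<in> D"
  obtain W g h where 1: "open W" "p \<in> W" "holomorphic2_on g W" "holomorphic2_on h W"
    "eventually (\<lambda>p. h p \<noteq> 0) (generic W)" "\<forall>x\<in>W. h x \<noteq> 0 \<longrightarrow> f x = g x / h x"
    by (rule meromorphic2_onE [OF assms(1) \<open>p \<in> D\<close>])
  have *: "eventually (\<lambda>p. g p * h p \<noteq> 0) (generic (W \<inter> D))"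
    using generic_subset [OF Int_lower2 assms(3)] generic_subset [OF Int_lower1 1(5)]
      eventually_generic_mem
    by eventually_elim (use 1(6) in simp)
  show "\<exists>W g h. open W \<and> p \<in> W \<and> holomorphic2_on g W \<and> holomorphic2_on h W \<and>
     eventually (\<lambda>p. h p \<noteq> 0) (generic W) \<and> (\<forall>x\<in>W. h x \<noteq> 0 \<longrightarrow> inverse (f x) = g x / h x)"
  proof (intro exI conjI)
    \<comment> \<open>The quotient is (h h) / (g h) and not h / g: where \<open>h\<close> vanishes
      the value of \<open>f\<close> is arbitrary, and the extra factor excludes these
      points.\<close>
    show "holomorphic2_on (\<lambda>p. h p * h p) (W \<inter> D)" "holomorphic2_on (\<lambda>p. g p * h p) (W \<inter> D)"
      by (intro holomorphic2_on_mult holomorphic2_on_subset [OF 1(3)] holomorphic2_on_subset [OF 1(4)]; simp)+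
    show "\<forall>x\<in>W \<inter> D. g x * h x \<noteq> 0 \<longrightarrow> inverse (f x) = (h x * h x) / (g x * h x)"
      using 1(6) by simp
  qed (use 1 * \<open>p \<in> D\<close> assms(2) in \<open>simp_all add: open_Int\<close>)
qed

text \<open>Open images prevent the map from sending an open set into the zero set of a local
  denominator.\<close>

lemma meromorphic2_on_compose:
  assumes f: "meromorphic2_on f E" and hol: "holomorphic2_on (\<lambda>p. fst (\<phi> p)) D"
    "holomorphic2_on (\<lambda>p. snd (\<phi> p)) D" and D: "open D" "\<phi> ` D \<subseteq> E"
    and img: "\<And>V. open V \<Longrightarrow> V \<subseteq> D \<Longrightarrow> open (\<phi> ` V)"
  shows "meromorphic2_on (\<lambda>p. f (\<phi> p)) D"
  unfolding meromorphic2_on_iff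
proof
  have cont: "continuous_on D \<phi>"
    using continuous_on_Pair [OF hol [THEN holomorphic2_on_continuous]] by simp
  fix p assume "p \<in> D"
  then have "\<phi> p \<in> E" using D by blast
  obtain W g h where 1: "open W" "\<phi> p \<in> W" "holomorphic2_on g W" "holomorphic2_on h W"
    "eventually (\<lambda>p. h p \<noteq> 0) (generic W)" "\<forall>x\<in>W. h x \<noteq> 0 \<longrightarrow> f x = g x / h x"
    by (rule meromorphic2_onE [OF f \<open>\<phi> p \<in> E\<close>])
  let ?W = "D \<inter> \<phi> -` W"
  have op: "open ?W" using cont D 1(1) by (simp add: continuous_open_preimage)
  have *: "eventually (\<lambda>p. h (\<phi> p) \<noteq> 0) (generic ?W)"
    using 1(5) by (rule generic_vimage) (use img cont op in \<open>auto intro: continuous_on_subset\<close>)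
  have hol': "holomorphic2_on (\<lambda>p. k (\<phi> p)) ?W" if "holomorphic2_on k W" for k
    using that by (rule holomorphic2_on_compose) (use hol in \<open>auto intro: holomorphic2_on_subset\<close>)
  show "\<exists>W g h. open W \<and> p \<in> W \<and> holomorphic2_on g W \<and> holomorphic2_on h W \<and>
     eventually (\<lambda>p. h p \<noteq> 0) (generic W) \<and> (\<forall>x\<in>W. h x \<noteq> 0 \<longrightarrow> f (\<phi> x) = g x / h x)"
  proof (intro exI conjI)
    show "holomorphic2_on (\<lambda>p. g (\<phi> p)) ?W" "holomorphic2_on (\<lambda>p. h (\<phi> p)) ?W"
      by (intro hol' 1)+
    show "\<forall>x\<in>?W. h (\<phi> x) \<noteq> 0 \<longrightarrow> f (\<phi> x) = g (\<phi> x) / h (\<phi> x)"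
      using 1(6) by simp
  qed (use 1 * op \<open>p \<in> D\<close> in simp_all)
qed

lemma meromorphic2_on_sum:
  "(\<And>i. i \<in> I \<Longrightarrow> meromorphic2_on (f i) D) \<Longrightarrow> meromorphic2_on (\<lambda>p. \<Sum>i\<in>I. f i p) D"
  by (induction I rule: infinite_finite_induct)
    (auto intro: meromorphic2_on_const meromorphic2_on_add)

lemma meromorphic2_on_prod:
  "(\<And>i. i \<in> I \<Longrightarrow> meromorphic2_on (f i) D) \<Longrightarrow> meromorphic2_on (\<lambda>p. \<Prod>i\<in>I. f i p) D"
  by (induction I rule: infinite_finite_induct)
    (auto intro: meromorphic2_on_const meromorphic2_on_mult)

section \<open>Matrices of meromorphic functions\<close>

lemma mero_matrix_subset: "mero_matrix E F \<Longrightarrow> D \<subseteq> E \<Longrightarrow> mero_matrix D F"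
  unfolding mero_matrix_def by (blast intro: meromorphic2_on_subset)

lemma mero_matrix_const: "mero_matrix D (\<lambda>_. A)"
  by (simp add: mero_matrix_def meromorphic2_on_const)

lemma mero_matrix_mult: "mero_matrix D F \<Longrightarrow> mero_matrix D G \<Longrightarrow> mero_matrix D (\<lambda>p. F p ** G p)"
  unfolding mero_matrix_def matrix_matrix_mult_def
  by (auto intro!: meromorphic2_on_sum meromorphic2_on_mult)

lemma meromorphic2_on_det: "mero_matrix D F \<Longrightarrow> meromorphic2_on (\<lambda>p. det (F p)) D"
  unfolding mero_matrix_def det_def
  by (auto intro!: meromorphic2_on_sum meromorphic2_on_mult meromorphic2_on_prod meromorphic2_on_const)

text \<open>Cramer's rule makes the entries of the inverse quotients of determinants.\<close>

lemma mero_matrix_inverse: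
  fixes F :: "complex \<times> complex \<Rightarrow> complex ^ 'n ^ 'n"
  assumes F: "mero_matrix D F" and "open D" and nz: "eventually (\<lambda>p. det (F p) \<noteq> 0) (generic D)"
  obtains G where "mero_matrix D G" "\<And>p. det (F p) \<noteq> 0 \<Longrightarrow> F p ** G p = mat 1 \<and> G p ** F p = mat 1"
proof
  \<comment> \<open>\<open>F p\<close> with column \<open>k\<close> replaced by the unit vector of
    index \<open>l\<close>, the numerator matrix in Cramer's rule.\<close>
  define C where "C p k l = (\<chi> i j. if j = k then mat 1 $ i $ l else F p $ i $ j)" for p and k l :: 'n
  define G where "G p = (\<chi> k l. det (C p k l) * inverse (det (F p)))" for p
  have "meromorphic2_on (\<lambda>p. C p k l $ i $ j) D" for k l i j
    using F by (cases "j = k") (simp_all add: C_def mero_matrix_def meromorphic2_on_const)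
  then have C: "mero_matrix D (\<lambda>p. C p k l)" for k l
    unfolding mero_matrix_def by (intro allI)
  show "mero_matrix D G"
    unfolding mero_matrix_def G_def
    by (auto intro!: meromorphic2_on_mult meromorphic2_on_inverse meromorphic2_on_det C assms)
  show "F p ** G p = mat 1 \<and> G p ** F p = mat 1" if "det (F p) \<noteq> 0" for p
  proof -
    have "F p *v column l (G p) = column l (mat 1)" for l
      by (subst cramer [OF that]) (simp add: G_def C_def vec_eq_iff column_def divide_inverse cong: if_cong)
    then have "F p ** G p = mat 1"
      by (simp add: vec_eq_iff matrix_matrix_mult_def matrix_vector_mult_def column_def)
    then show ?thesis using matrix_left_right_inverse by blast
  qed
qed

section \<open>The modular action\<close>

lemma open_dom0: "open dom0"
  unfolding dom0_def by (intro open_Times open_UNIV) (simp add: closed_complex_Reals open_Compl)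

lemma mem_dom0: "p \<in> dom0 \<longleftrightarrow> snd p \<notin> \<real>"
  by (cases p) (simp add: dom0_def)

lemma mero_eq_dom0: "mero_eq dom0 F G \<longleftrightarrow> (\<forall>\<^sub>F p in generic dom0. F p = G p)"
  by (rule mero_eq_generic [OF open_dom0])

lemma closure_nonreal: "closure (- \<real> :: complex set) = UNIV"
proof -
  have "interior \<real> = ({} :: complex set)"
  proof (rule ccontr)
    assume "interior \<real> \<noteq> ({} :: complex set)"
    then obtain x :: complex and e where e: "e > 0" "ball x e \<subseteq> \<real>"
      by (metis equals0I mem_interior)
    have "dist x (x + \<i> * of_real (e / 2)) < e"
      using e(1) by (simp add: dist_norm norm_mult)
    then have "x + \<i> * of_real (e / 2) \<in> \<real>" "x \<in> \<real>" using e by (auto intro: subsetD [OF e(2)])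
    then have "\<i> * of_real (e / 2) \<in> \<real>" by (metis Reals_diff add_diff_cancel_left')
    then show False using e(1) by (simp add: complex_is_Real_iff)
  qed
  then show ?thesis by (simp add: closure_interior)
qed

lemma closure_dom0: "closure dom0 = UNIV"
  by (simp add: dom0_def closure_Times closure_nonreal)

definition regular :: "int ^ 2 ^ 2 \<Rightarrow> (complex \<times> complex) set" where
  "regular \<gamma> = {p. autf \<gamma> (snd p) \<noteq> 0}"

lemma autf_mat2: "autf (mat2 a b c d) \<tau> = of_int c * \<tau> + of_int d"
  by (simp add: autf_def)

lemma act_mat2: "act (mat2 a b c d) (z, \<tau>) =
    (z / (of_int c * \<tau> + of_int d), (of_int a * \<tau> + of_int b) / (of_int c * \<tau> + of_int d))"
  by (simp add: act_def autf_mat2)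

lemma autf_one [simp]: "autf (mat 1) \<tau> = 1" and act_one [simp]: "act (mat 1) p = p"
  by (cases p; simp add: mat2_one autf_mat2 act_mat2)+

text \<open>The inner factor \<open>m\<close> cancels from numerator and denominator. If the outer
  factor vanishes, both sides divide by zero and agree by convention.\<close>

lemma act_mult:
  assumes "autf \<gamma>' (snd p) \<noteq> 0"
  shows "act (\<gamma> ** \<gamma>') p = act \<gamma> (act \<gamma>' p)"
    and autf_mult: "autf (\<gamma> ** \<gamma>') (snd p) = autf \<gamma> (snd (act \<gamma>' p)) * autf \<gamma>' (snd p)"
proof -
  obtain z \<tau> where p: "p = (z, \<tau>)" by (rule prod.exhaust)
  obtain a b c d where \<gamma>: "\<gamma> = mat2 a b c d" by (rule mat2_cases)
  obtain a' b' c' d' where \<gamma>': "\<gamma>' = mat2 a' b' c' d'" by (rule mat2_cases)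
  define m where "m = of_int c' * \<tau> + of_int d'"
  define n where "n = of_int a' * \<tau> + of_int b'"
  have "m \<noteq> 0" using assms by (simp add: p \<gamma>' autf_mat2 m_def)
  define x where "x = n / m"
  have e: "of_int u * x + of_int v = (of_int u * n + of_int v * m) / m" for u v
    using \<open>m \<noteq> 0\<close> by (simp add: x_def add_divide_distrib)
  have act': "act \<gamma>' p = (z / m, x)" and autf': "autf \<gamma>' (snd p) = m"
    by (simp_all add: p \<gamma>' act_mat2 autf_mat2 m_def n_def x_def)
  have comb: "of_int (u * a' + v * c') * \<tau> + of_int (u * b' + v * d') = of_int u * n + of_int v * m" for u v
    by (simp add: m_def n_def algebra_simps)
  have f: "k / m / (l / m) = k / l" and g: "k = k / m * m" for k l
    using \<open>m \<noteq> 0\<close> by simp_all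
  show "act (\<gamma> ** \<gamma>') p = act \<gamma> (act \<gamma>' p)"
    unfolding act' unfolding p \<gamma> \<gamma>' mat2_mult act_mat2 comb e f ..
  show "autf (\<gamma> ** \<gamma>') (snd p) = autf \<gamma> (snd (act \<gamma>' p)) * autf \<gamma>' (snd p)"
    unfolding act' autf' unfolding p \<gamma> \<gamma>' mat2_mult autf_mat2 snd_conv comb e by (rule g)
qed

lemma autf_nonzero:
  assumes "\<gamma> \<in> SL2Z" "\<tau> \<notin> \<real>"
  shows "autf \<gamma> \<tau> \<noteq> 0"
proof (cases \<gamma> rule: mat2_cases)
  case (mat2 a b c d)
  show ?thesis
  proof
    assume "autf \<gamma> \<tau> = 0"
    then have 0: "of_int c * \<tau> = - of_int d" by (simp add: mat2 autf_mat2 eq_neg_iff_add_eq_0)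
    show False
    proof (cases "c = 0")
      case True
      then show False using 0 assms(1) mat2 by simp
    next
      case False
      then have "\<tau> = - of_int d / of_int c" using 0 by (simp add: field_simps)
      then show False using assms(2) by (simp add: Reals_divide)
    qed
  qed
qed

lemma dom0_regular: "\<gamma> \<in> SL2Z \<Longrightarrow> dom0 \<subseteq> regular \<gamma>"
  by (auto simp: mem_dom0 regular_def autf_nonzero)

lemma act_inverse:
  assumes "\<gamma> \<in> SL2Z" "p \<in> regular \<gamma>"
  shows "act (SL2Z_inv \<gamma>) (act \<gamma> p) = p"
    and "autf (SL2Z_inv \<gamma>) (snd (act \<gamma> p)) * autf \<gamma> (snd p) = 1"
  using assms act_mult [of \<gamma> p "SL2Z_inv \<gamma>"] autf_mult [of \<gamma> p "SL2Z_inv \<gamma>"]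
  by (simp_all add: SL2Z_inv regular_def)

lemma act_regular: "\<gamma> \<in> SL2Z \<Longrightarrow> p \<in> regular \<gamma> \<Longrightarrow> act \<gamma> p \<in> regular (SL2Z_inv \<gamma>)"
  using act_inverse(2) [of \<gamma> p] by (auto simp: regular_def)

lemma SL2Z_inv_inv [simp]: "SL2Z_inv (SL2Z_inv \<gamma>) = \<gamma>"
  by (cases \<gamma> rule: mat2_cases) (simp add: SL2Z_inv_def)

text \<open>Integer matrices send real second coordinates to real ones, so a real image would be
  brought back to a real point by the inverse.\<close>

lemma act_dom0:
  assumes "\<gamma> \<in> SL2Z" "p \<in> dom0"
  shows "act \<gamma> p \<in> dom0"
proof -
  have p: "p \<in> regular \<gamma>" using assms dom0_regular by blast
  have "snd (act \<gamma>' q) \<in> \<real>" if "snd q \<in> \<real>" for \<gamma>' q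
    using that by (cases q) (auto simp: act_def autf_def)
  from this [of "act \<gamma> p" "SL2Z_inv \<gamma>"] show ?thesis
    using assms by (auto simp: act_inverse(1) [OF assms(1) p] mem_dom0)
qed

lemma act_mult_dom0: "\<gamma>' \<in> SL2Z \<Longrightarrow> p \<in> dom0 \<Longrightarrow> act (\<gamma> ** \<gamma>') p = act \<gamma> (act \<gamma>' p)"
  by (intro act_mult autf_nonzero) (simp_all add: mem_dom0)

lemma holomorphic2_on_autf: "holomorphic2_on (\<lambda>p. autf \<gamma> (snd p)) D"
  unfolding autf_def
  by (intro holomorphic2_on_add holomorphic2_on_mult holomorphic2_on_const holomorphic2_on_snd)

lemma holomorphic2_on_act:
  "holomorphic2_on (\<lambda>p. fst (act \<gamma> p)) (regular \<gamma>)" "holomorphic2_on (\<lambda>p. snd (act \<gamma> p)) (regular \<gamma>)"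
  unfolding act_def case_prod_unfold fst_conv snd_conv
  by (intro holomorphic2_on_divide holomorphic2_on_autf holomorphic2_on_add holomorphic2_on_mult
      holomorphic2_on_const holomorphic2_on_snd holomorphic2_on_fst; simp add: regular_def)+

lemma continuous_on_act: "continuous_on (regular \<gamma>) (act \<gamma>)"
  using continuous_on_Pair [OF holomorphic2_on_act [THEN holomorphic2_on_continuous, of \<gamma>]] by simp

lemma open_regular: "open (regular \<gamma>)"
proof -
  have "continuous_on UNIV (\<lambda>p :: complex \<times> complex. autf \<gamma> (snd p))"
    by (rule holomorphic2_on_continuous [OF holomorphic2_on_autf])
  then have "open (UNIV \<inter> (\<lambda>p :: complex \<times> complex. autf \<gamma> (snd p)) -` (- {0}))"
    by (rule continuous_open_preimage) auto
  moreover have "UNIV \<inter> (\<lambda>p. autf \<gamma> (snd p)) -` (- {0}) = regular \<gamma>"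
    by (auto simp: regular_def)
  ultimately show ?thesis by simp
qed

text \<open>The image is a preimage under the inverse matrix, hence open by continuity.\<close>

lemma open_act_image:
  assumes "\<gamma> \<in> SL2Z" "open V" "V \<subseteq> regular \<gamma>"
  shows "open (act \<gamma> ` V)"
proof -
  let ?\<delta> = "SL2Z_inv \<gamma>"
  have "act \<gamma> ` V = regular ?\<delta> \<inter> act ?\<delta> -` V"
  proof (intro equalityI subsetI)
    fix q assume "q \<in> act \<gamma> ` V"
    then obtain p where p: "q = act \<gamma> p" "p \<in> V" by (rule imageE)
    then have "p \<in> regular \<gamma>" using assms(3) by (metis subsetD)
    then show "q \<in> regular ?\<delta> \<inter> act ?\<delta> -` V"
      using act_regular [OF assms(1)] act_inverse(1) [OF assms(1)] p by simp
  next
    fix q assume q: "q \<in> regular ?\<delta> \<inter> act ?\<delta> -` V"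
    then have "q = act \<gamma> (act ?\<delta> q)"
      using act_inverse(1) [of ?\<delta> q] assms(1) by (simp add: SL2Z_inv)
    moreover have "act ?\<delta> q \<in> V" using q by simp
    ultimately show "q \<in> act \<gamma> ` V" by (rule image_eqI)
  qed
  also have "open \<dots>"
    by (rule continuous_open_preimage [OF continuous_on_act open_regular assms(2)])
  finally show ?thesis .
qed

lemma generic_act:
  assumes "\<gamma> \<in> SL2Z" "eventually P (generic dom0)"
  shows "eventually (\<lambda>p. P (act \<gamma> p)) (generic dom0)"
proof (rule generic_vimage [OF assms(2)])
  show "continuous_on dom0 (act \<gamma>)"
    using continuous_on_act dom0_regular [OF assms(1)] by (rule continuous_on_subset)
  show "open (act \<gamma> ` V)" if "open V" "V \<subseteq> dom0" for V
    using assms(1) that(1) subset_trans [OF that(2) dom0_regular [OF assms(1)]] by (rule open_act_image)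
  show "act \<gamma> ` dom0 \<subseteq> dom0"
    using act_dom0 [OF assms(1)] by (rule image_subsetI)
qed (rule open_dom0)

lemma mero_matrix_act:
  assumes "\<gamma> \<in> SL2Z" "mero_matrix E F" "open D" "D \<subseteq> regular \<gamma>" "act \<gamma> ` D \<subseteq> E"
  shows "mero_matrix D (\<lambda>p. F (act \<gamma> p))"
  unfolding mero_matrix_def
proof (intro allI)
  fix i j
  have "meromorphic2_on (\<lambda>p. F p $ i $ j) E" using assms(2) by (simp add: mero_matrix_def)
  then show "meromorphic2_on (\<lambda>p. F (act \<gamma> p) $ i $ j) D"
  proof (rule meromorphic2_on_compose)
    show "open (act \<gamma> ` V)" if "open V" "V \<subseteq> D" for V
      using assms(1) that(1) subset_trans [OF that(2) assms(4)] by (rule open_act_image)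
    show "holomorphic2_on (\<lambda>p. fst (act \<gamma> p)) D" "holomorphic2_on (\<lambda>p. snd (act \<gamma> p)) D"
      by (rule holomorphic2_on_subset [OF holomorphic2_on_act(1) assms(4)]
          holomorphic2_on_subset [OF holomorphic2_on_act(2) assms(4)])+
  qed fact+
qed

text \<open>Cramer's rule supplies the meromorphic inverse, so that invertibility reduces to a
  generic condition on a determinant, stable under products and substitutions.\<close>

lemma invertible_mero_matrix_iff:
  fixes F :: "complex \<times> complex \<Rightarrow> complex ^ 'n ^ 'n"
  assumes "open D"
  shows "invertible_mero_matrix D F \<longleftrightarrow> mero_matrix D F \<and> (\<forall>\<^sub>F p in generic D. det (F p) \<noteq> 0)"
proof
  assume "invertible_mero_matrix D F"
  then obtain G where G: "mero_matrix D F" "\<forall>\<^sub>F p in generic D. F p ** G p = mat 1"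
    unfolding invertible_mero_matrix_def mero_eq_generic [OF assms] by blast
  from G(2) have "\<forall>\<^sub>F p in generic D. det (F p) \<noteq> 0"
  proof eventually_elim
    case (elim p)
    then have "det (F p) * det (G p) = 1" by (metis det_I det_mul)
    then show ?case by auto
  qed
  with G(1) show "mero_matrix D F \<and> (\<forall>\<^sub>F p in generic D. det (F p) \<noteq> 0)" by blast
next
  assume F: "mero_matrix D F \<and> (\<forall>\<^sub>F p in generic D. det (F p) \<noteq> 0)"
  then obtain G where "mero_matrix D G" "\<And>p. det (F p) \<noteq> 0 \<Longrightarrow> F p ** G p = mat 1 \<and> G p ** F p = mat 1"
    using mero_matrix_inverse [of D F] assms by blast
  with F show "invertible_mero_matrix D F"
    unfolding invertible_mero_matrix_def mero_eq_generic [OF assms]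
    by (auto intro!: exI [of _ G] elim: eventually_mono)
qed

lemmas invertible_dom0 = invertible_mero_matrix_iff [OF open_dom0]

lemma invertible_mero_matrix_one: "invertible_mero_matrix dom0 (\<lambda>_. mat 1)"
  by (simp add: invertible_dom0 mero_matrix_const)

lemma invertible_mero_matrix_mult:
  assumes "invertible_mero_matrix dom0 F" "invertible_mero_matrix dom0 G"
  shows "invertible_mero_matrix dom0 (\<lambda>p. F p ** G p)"
  using assms by (auto simp: invertible_dom0 det_mul intro: mero_matrix_mult eventually_conj)

lemma invertible_mero_matrix_act:
  assumes "\<gamma> \<in> SL2Z" "invertible_mero_matrix dom0 F"
  shows "invertible_mero_matrix dom0 (\<lambda>p. F (act \<gamma> p))"
proof -
  have "act \<gamma> ` dom0 \<subseteq> dom0" using act_dom0 [OF assms(1)] by (rule image_subsetI)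
  then show ?thesis
    using assms(2) generic_act [OF assms(1), of "\<lambda>p. det (F p) \<noteq> 0"] dom0_regular [OF assms(1)]
    using mero_matrix_act [OF assms(1) _ open_dom0, of dom0 F] by (simp add: invertible_dom0)
qed

section \<open>Cocycles\<close>

lemma diag_mat_one: "diag_mat (\<lambda>i. 1) = mat 1"
  by (simp add: diag_mat_def mat_def)

lemma diag_mat_mult: "diag_mat d ** diag_mat e = diag_mat (\<lambda>i. d i * e i)"
  by (simp add: diag_mat_def matrix_matrix_mult_def vec_eq_iff if_distrib [of "\<lambda>x. x * _"] sum.delta' cong: if_cong)

lemma modular_eq_iff:
  "modular_eq \<kappa> \<mu> M \<gamma> \<longleftrightarrow> (\<forall>\<^sub>F p in generic dom0. M p =
     diag_mat (\<lambda>i. autf \<gamma> (snd p) powi (\<mu> $ i)) ** (M (act \<gamma> p) **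
     diag_mat (\<lambda>i. autf \<gamma> (snd p) powi (- (\<kappa> $ i)))))"
  by (simp add: modular_eq_def mero_eq_dom0 slash_def Delta_def case_prod_unfold)

lemma modular_eq_mult:
  assumes \<gamma>: "\<gamma> \<in> SL2Z" "modular_eq \<kappa> \<mu> M \<gamma>" and \<gamma>': "\<gamma>' \<in> SL2Z" "modular_eq \<kappa> \<mu> M \<gamma>'"
  shows "modular_eq \<kappa> \<mu> M (\<gamma> ** \<gamma>')"
  unfolding modular_eq_iff
  using generic_act [OF \<gamma>'(1) \<gamma>(2) [unfolded modular_eq_iff]] \<gamma>'(2) [unfolded modular_eq_iff]
    eventually_generic_mem [of dom0]
proof eventually_elim
  case (elim p)
  let ?j = "autf \<gamma> (snd (act \<gamma>' p))" and ?j' = "autf \<gamma>' (snd p)"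
  have nz: "?j' \<noteq> 0"
    using elim(3) \<gamma>'(1) by (intro autf_nonzero) (simp_all add: mem_dom0)
  \<comment> \<open>The equation for \<open>\<gamma>'\<close> is used at \<open>p\<close> and the
    one for \<open>\<gamma>\<close> at the image point. The diagonal factors then merge into powers
    of the automorphy factor of the product.\<close>
  have "M p = (diag_mat (\<lambda>i. ?j' powi (\<mu> $ i)) ** diag_mat (\<lambda>i. ?j powi (\<mu> $ i))) **
      (M (act \<gamma> (act \<gamma>' p)) ** (diag_mat (\<lambda>i. ?j powi (- (\<kappa> $ i))) ** diag_mat (\<lambda>i. ?j' powi (- (\<kappa> $ i)))))"
    by (subst elim(2), subst elim(1)) (simp only: matrix_mul_assoc)
  then show ?case
    unfolding diag_mat_mult act_mult [OF nz] autf_mult [OF nz] power_int_mult_distrib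
    by (simp only: mult.commute)
qed

lemma modular_eq_one: "modular_eq \<kappa> \<mu> M (mat 1)"
  by (simp add: modular_eq_iff diag_mat_one)

lemma modular_eq_generators:
  assumes "modular_eq \<kappa> \<mu> M S_mat" "modular_eq \<kappa> \<mu> M T_mat" "\<gamma> \<in> SL2Z"
  shows "modular_eq \<kappa> \<mu> M \<gamma>"
  using assms(3)
  by (induction rule: SL2Z_induct) (auto intro: modular_eq_one modular_eq_mult assms)

section \<open>Cocycles with trivial value at T\<close>

locale T_trivial_cocycle =
  fixes \<Omega> :: "int ^ 2 ^ 2 \<Rightarrow> complex \<times> complex \<Rightarrow> complex ^ 'n ^ 'n"
  assumes cocycle: "SL2Z_cocycle \<Omega>"
    and T_trivial: "mero_eq dom0 (\<Omega> T_mat) (\<lambda>_. mat 1)"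
begin

lemma cocycle_mult:
  assumes "\<gamma> \<in> SL2Z" "\<gamma>' \<in> SL2Z"
  shows "\<forall>\<^sub>F p in generic dom0. \<Omega> (\<gamma> ** \<gamma>') p = \<Omega> \<gamma> (act \<gamma>' p) ** \<Omega> \<gamma>' p"
  using cocycle assms by (simp add: SL2Z_cocycle_def mero_eq_dom0)

lemma cocycle_mero: "\<gamma> \<in> SL2Z \<Longrightarrow> mero_matrix dom0 (\<Omega> \<gamma>)"
  and cocycle_det: "\<gamma> \<in> SL2Z \<Longrightarrow> \<forall>\<^sub>F p in generic dom0. det (\<Omega> \<gamma> p) \<noteq> 0"
  using cocycle by (simp_all add: SL2Z_cocycle_def invertible_dom0)

text \<open>The cocycle identity makes this value idempotent, and a generically invertible
  idempotent is the identity.\<close>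

lemma cocycle_one: "\<forall>\<^sub>F p in generic dom0. \<Omega> (mat 1) p = mat 1"
proof -
  have one: "mat 1 \<in> SL2Z" by simp
  show ?thesis
    using cocycle_mult [OF one one] cocycle_det [OF one]
  proof eventually_elim
    case (elim p)
    then obtain B where "B ** \<Omega> (mat 1) p = mat 1"
      using invertible_det_nz invertible_def by blast
    then show ?case using elim(1) by (metis act_one matrix_mul_assoc matrix_mul_lid)
  qed
qed

lemma cocycle_T:
  assumes "\<gamma> \<in> SL2Z"
  shows "\<forall>\<^sub>F p in generic dom0. \<Omega> (T_mat ** \<gamma>) p = \<Omega> \<gamma> p"
proof -
  have "\<forall>\<^sub>F p in generic dom0. \<Omega> T_mat (act \<gamma> p) = mat 1"
    using generic_act [OF assms] T_trivial [unfolded mero_eq_dom0] by blast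
  moreover have "\<forall>\<^sub>F p in generic dom0. \<Omega> (T_mat ** \<gamma>) p = \<Omega> T_mat (act \<gamma> p) ** \<Omega> \<gamma> p"
    using assms by (simp add: cocycle_mult)
  ultimately show ?thesis by eventually_elim simp
qed

lemma cocycle_Tpow: "\<forall>\<^sub>F p in generic dom0. \<Omega> (Tpow k) p = mat 1"
proof -
  have "\<forall>\<^sub>F p in generic dom0. \<Omega> (Tpow k ** mat 1) p = mat 1"
  proof (rule Tpow_induct)
    fix k assume *: "\<forall>\<^sub>F p in generic dom0. \<Omega> (Tpow k ** mat 1) p = mat 1"
    have "Tpow (k + 1) ** mat 1 = T_mat ** Tpow k" "Tpow k ** mat 1 = T_mat ** Tpow (k - 1)"
      by (simp_all add: Tpow_def mat2_one T_mat_eq)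
    with * cocycle_T [of "Tpow k"] cocycle_T [of "Tpow (k - 1)"]
    show "\<forall>\<^sub>F p in generic dom0. \<Omega> (Tpow (k + 1) ** mat 1) p = mat 1"
      "\<forall>\<^sub>F p in generic dom0. \<Omega> (Tpow (k - 1) ** mat 1) p = mat 1"
      by (auto elim: eventually_elim2)
  qed (rule cocycle_one)
  then show ?thesis by simp
qed

end

text \<open>Each substitution in the functional equations is the action of a word in S and T. The
  right-nested products match successive left multiplications by S.\<close>

lemma S_equations_iff:
  "S_equations W \<longleftrightarrow>
     (\<forall>\<^sub>F p in generic dom0.
        W (act (- S_mat) p) ** (W (act (- mat 1) p) ** (W (act S_mat p) ** W p)) = mat 1) \<and>
     (\<forall>\<^sub>F p in generic dom0. W p = W (act (T_mat ** (S_mat ** T_mat)) p) ** W (act T_mat p))"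
proof -
  have "act (- S_mat) p = (- fst p / snd p, - 1 / snd p)" "act (- mat 1) p = (- fst p, snd p)"
    "act S_mat p = (fst p / snd p, - 1 / snd p)" "act T_mat p = (fst p, snd p + 1)"
    "act (T_mat ** (S_mat ** T_mat)) p = (fst p / (snd p + 1), snd p / (snd p + 1))" for p
    by (cases p; simp add: S_mat_eq T_mat_eq mat2_one act_mat2)+
  then show ?thesis
    unfolding S_equations_def mero_eq_dom0 case_prod_unfold
    by (simp add: matrix_mul_assoc eq_commute [of "mat 1"])
qed

lemma (in T_trivial_cocycle) cocycle_S_equations: "S_equations (\<Omega> S_mat)"
proof -
  note SS = SL2Z_generators SL2Z_mult SL2Z_uminus
  have "S_mat ** mat 1 = S_mat" "S_mat ** S_mat = - mat 1" "S_mat ** (- mat 1) = - S_mat"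
    "S_mat ** (- S_mat) = mat 1"
    by (simp_all add: S_mat_eq mat2_one)
  then have "\<forall>\<^sub>F p in generic dom0. \<Omega> (- mat 1) p = \<Omega> S_mat (act S_mat p) ** \<Omega> S_mat p"
    "\<forall>\<^sub>F p in generic dom0. \<Omega> (- S_mat) p = \<Omega> S_mat (act (- mat 1) p) ** \<Omega> (- mat 1) p"
    "\<forall>\<^sub>F p in generic dom0. \<Omega> (mat 1) p = \<Omega> S_mat (act (- S_mat) p) ** \<Omega> (- S_mat) p"
    using cocycle_mult [of S_mat S_mat] cocycle_mult [of S_mat "- mat 1"] cocycle_mult [of S_mat "- S_mat"]
    by (simp_all add: SS del: matrix_mul_rid)
  then have 1: "\<forall>\<^sub>F p in generic dom0.
      \<Omega> S_mat (act (- S_mat) p) ** (\<Omega> S_mat (act (- mat 1) p) ** (\<Omega> S_mat (act S_mat p) ** \<Omega> S_mat p)) = mat 1"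
    using cocycle_one by eventually_elim simp
  \<comment> \<open>With U = TST the relation S = TSTST reads S = TSU, and the leading
    \<open>T\<close> on either side is dropped by \<open>cocycle_T\<close>.\<close>
  let ?U = "T_mat ** (S_mat ** T_mat)"
  have "T_mat ** (S_mat ** ?U) = S_mat"
    by (simp add: S_mat_eq T_mat_eq)
  then have "\<forall>\<^sub>F p in generic dom0. \<Omega> S_mat p = \<Omega> (S_mat ** ?U) p"
    using cocycle_T [of "S_mat ** ?U"] by simp
  moreover have "\<forall>\<^sub>F p in generic dom0. \<Omega> (S_mat ** ?U) p = \<Omega> S_mat (act ?U p) ** \<Omega> ?U p"
    "\<forall>\<^sub>F p in generic dom0. \<Omega> ?U p = \<Omega> (S_mat ** T_mat) p"
    "\<forall>\<^sub>F p in generic dom0. \<Omega> (S_mat ** T_mat) p = \<Omega> S_mat (act T_mat p) ** \<Omega> T_mat p"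
    "\<forall>\<^sub>F p in generic dom0. \<Omega> T_mat p = mat 1"
    using T_trivial by (simp_all add: cocycle_mult cocycle_T mero_eq_dom0)
  ultimately have 2: "\<forall>\<^sub>F p in generic dom0. \<Omega> S_mat p = \<Omega> S_mat (act ?U p) ** \<Omega> S_mat (act T_mat p)"
    by eventually_elim simp
  show ?thesis unfolding S_equations_iff using 1 2 by blast
qed

text \<open>The locale \<^locale>\<open>SL2Z_relations\<close> needs honest equalities, so classes of matrices modulo
  equality on a dense open set are replaced by chosen representatives.\<close>

definition mero_rep :: "(complex \<times> complex \<Rightarrow> complex ^ 'n ^ 'n) \<Rightarrow> complex \<times> complex \<Rightarrow> complex ^ 'n ^ 'n" where
  "mero_rep F = (SOME G. invertible_mero_matrix dom0 G \<and> (\<forall>\<^sub>F p in generic dom0. G p = F p))"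

lemma mero_rep:
  assumes "invertible_mero_matrix dom0 F"
  shows "invertible_mero_matrix dom0 (mero_rep F)" "\<forall>\<^sub>F p in generic dom0. mero_rep F p = F p"
proof -
  have "\<exists>G. invertible_mero_matrix dom0 G \<and> (\<forall>\<^sub>F p in generic dom0. G p = F p)"
    using assms by (intro exI [of _ F]) simp
  from someI_ex [OF this] show "invertible_mero_matrix dom0 (mero_rep F)"
    "\<forall>\<^sub>F p in generic dom0. mero_rep F p = F p"
    unfolding mero_rep_def by simp_all
qed

text \<open>Generically equal functions pose the same condition to \<open>SOME\<close>, so the same
  representative is chosen.\<close>

lemma mero_rep_cong:
  assumes "\<forall>\<^sub>F p in generic dom0. F p = G p"
  shows "mero_rep F = mero_rep G"
proof -
  have "(\<forall>\<^sub>F p in generic dom0. H p = F p) \<longleftrightarrow> (\<forall>\<^sub>F p in generic dom0. H p = G p)" for H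
    using assms by (auto elim: eventually_elim2)
  then show ?thesis by (simp add: mero_rep_def)
qed

lemma mero_rep_idem: "invertible_mero_matrix dom0 F \<Longrightarrow> mero_rep (mero_rep F) = mero_rep F"
  by (intro mero_rep_cong mero_rep)

definition canonical_mero :: "(complex \<times> complex \<Rightarrow> complex ^ 'n ^ 'n) set" where
  "canonical_mero = {F. invertible_mero_matrix dom0 F \<and> mero_rep F = F}"

lemma canonical_mero_rep: "invertible_mero_matrix dom0 F \<Longrightarrow> mero_rep F \<in> canonical_mero"
  by (simp add: canonical_mero_def mero_rep mero_rep_idem)

lemma canonical_mero_eqI:
  assumes "F \<in> canonical_mero" "G \<in> canonical_mero" "\<forall>\<^sub>F p in generic dom0. F p = G p"
  shows "F = G"
  using mero_rep_cong [OF assms(3)] assms(1,2) by (simp add: canonical_mero_def)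

text \<open>With \<open>W\<close> as the value at S, this is the cocycle identity passing from the
  value \<open>F\<close> at \<open>\<gamma>\<close> to the value at S
  \<open>\<gamma>\<close>.\<close>

definition cocycle_step ::
  "(complex \<times> complex \<Rightarrow> complex ^ 'n ^ 'n) \<Rightarrow> int ^ 2 ^ 2 \<Rightarrow>
   (complex \<times> complex \<Rightarrow> complex ^ 'n ^ 'n) \<Rightarrow> complex \<times> complex \<Rightarrow> complex ^ 'n ^ 'n" where
  "cocycle_step W \<gamma> F = mero_rep (\<lambda>p. W (act \<gamma> p) ** F p)"

section \<open>Construction of a cocycle from its value at S\<close>

locale S_equations_solution =
  fixes W :: "complex \<times> complex \<Rightarrow> complex ^ 'n ^ 'n"
  assumes W: "invertible_mero_matrix dom0 W" and S_equations: "S_equations W"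
begin

lemma step_invertible:
  assumes "\<gamma> \<in> SL2Z" "F \<in> canonical_mero"
  shows "invertible_mero_matrix dom0 (\<lambda>p. W (act \<gamma> p) ** F p)"
  using assms W by (auto simp: canonical_mero_def intro: invertible_mero_matrix_mult invertible_mero_matrix_act)

lemma step_canonical: "\<gamma> \<in> SL2Z \<Longrightarrow> F \<in> canonical_mero \<Longrightarrow> cocycle_step W \<gamma> F \<in> canonical_mero"
  by (simp add: cocycle_step_def canonical_mero_rep step_invertible)

lemma step_eq:
  "\<gamma> \<in> SL2Z \<Longrightarrow> F \<in> canonical_mero \<Longrightarrow>
    \<forall>\<^sub>F p in generic dom0. cocycle_step W \<gamma> F p = W (act \<gamma> p) ** F p"
  unfolding cocycle_step_def by (intro mero_rep step_invertible)

text \<open>The functional equations, taken at \<open>act \<gamma> p\<close>, become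
  \<open>S4\<close> and \<open>STS\<close>. They hold generically, and canonical representatives
  upgrade them to equalities.\<close>

sublocale SL2Z_relations canonical_mero "cocycle_step W"
proof
  fix \<gamma> and F :: "complex \<times> complex \<Rightarrow> complex ^ 'n ^ 'n"
  assume \<gamma>: "\<gamma> \<in> SL2Z" and F: "F \<in> canonical_mero"
  show "cocycle_step W \<gamma> F \<in> canonical_mero" using \<gamma> F by (rule step_canonical)
  have neg: "- (S_mat ** \<gamma>) = - S_mat ** \<gamma>" "- \<gamma> = - mat 1 ** \<gamma>"
    by (cases \<gamma> rule: mat2_cases; simp add: S_mat_eq mat2_one)+
  let ?F1 = "cocycle_step W \<gamma> F"
  let ?F2 = "cocycle_step W (S_mat ** \<gamma>) ?F1"
  let ?F3 = "cocycle_step W (- \<gamma>) ?F2"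
  let ?F4 = "cocycle_step W (- (S_mat ** \<gamma>)) ?F3"
  have F1: "?F1 \<in> canonical_mero" using \<gamma> F by (rule step_canonical)
  have F2: "?F2 \<in> canonical_mero" using \<gamma> F1 by (simp add: step_canonical)
  have F3: "?F3 \<in> canonical_mero" using \<gamma> F2 by (simp add: step_canonical)
  have F4: "?F4 \<in> canonical_mero" using \<gamma> F3 by (simp add: step_canonical)
  have "\<forall>\<^sub>F p in generic dom0. ?F4 p = W (act (- (S_mat ** \<gamma>)) p) ** ?F3 p"
    "\<forall>\<^sub>F p in generic dom0. ?F3 p = W (act (- \<gamma>) p) ** ?F2 p"
    "\<forall>\<^sub>F p in generic dom0. ?F2 p = W (act (S_mat ** \<gamma>) p) ** ?F1 p"
    "\<forall>\<^sub>F p in generic dom0. ?F1 p = W (act \<gamma> p) ** F p"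
    using \<gamma> F F1 F2 F3 by (simp_all add: step_eq)
  moreover from S_equations have "\<forall>\<^sub>F p in generic dom0.
      W (act (- S_mat) p) ** (W (act (- mat 1) p) ** (W (act S_mat p) ** W p)) = mat 1"
    by (simp add: S_equations_iff)
  note generic_act [OF \<gamma> this]
  ultimately have "\<forall>\<^sub>F p in generic dom0. ?F4 p = F p"
    using eventually_generic_mem [of dom0]
  proof eventually_elim
    case (elim p)
    let ?q = "act \<gamma> p"
    have "?F4 p = (W (act (- S_mat) ?q) ** (W (act (- mat 1) ?q) ** (W (act S_mat ?q) ** W ?q))) ** F p"
      unfolding elim(1-4) unfolding neg act_mult_dom0 [OF \<gamma> elim(6)] by (simp only: matrix_mul_assoc)
    then show ?case by (simp only: elim(5) matrix_mul_lid)
  qed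
  then show "?F4 = F" by (rule canonical_mero_eqI [OF F4 F])
  let ?U = "T_mat ** (S_mat ** T_mat)"
  let ?G1 = "cocycle_step W (T_mat ** \<gamma>) F"
  let ?G2 = "cocycle_step W (T_mat ** (S_mat ** (T_mat ** \<gamma>))) ?G1"
  have G1: "?G1 \<in> canonical_mero" using \<gamma> F by (simp add: step_canonical)
  have G2: "?G2 \<in> canonical_mero" using \<gamma> G1 by (simp add: step_canonical)
  have "\<forall>\<^sub>F p in generic dom0. ?G2 p = W (act (T_mat ** (S_mat ** (T_mat ** \<gamma>))) p) ** ?G1 p"
    "\<forall>\<^sub>F p in generic dom0. ?G1 p = W (act (T_mat ** \<gamma>) p) ** F p"
    "\<forall>\<^sub>F p in generic dom0. ?F1 p = W (act \<gamma> p) ** F p"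
    using \<gamma> F G1 by (simp_all add: step_eq)
  moreover from S_equations have "\<forall>\<^sub>F p in generic dom0. W p = W (act ?U p) ** W (act T_mat p)"
    by (simp add: S_equations_iff)
  note generic_act [OF \<gamma> this]
  ultimately have "\<forall>\<^sub>F p in generic dom0. ?G2 p = ?F1 p"
    using eventually_generic_mem [of dom0]
  proof eventually_elim
    case (elim p)
    have U: "T_mat ** (S_mat ** (T_mat ** \<gamma>)) = ?U ** \<gamma>" by (simp only: matrix_mul_assoc)
    have "?G2 p = (W (act ?U (act \<gamma> p)) ** W (act T_mat (act \<gamma> p))) ** F p"
      unfolding elim(1,2) unfolding U act_mult_dom0 [OF \<gamma> elim(5)] by (simp only: matrix_mul_assoc)
    then show ?case by (simp only: elim(3,4))
  qed
  then show "?G2 = ?F1" by (rule canonical_mero_eqI [OF G2 F1])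
qed

text \<open>The cocycle is the orbit of the representative of the identity matrix. Its
  multiplicativity follows by induction on the left factor from \<open>orbit_T\<close> and
  \<open>orbit_S\<close>.\<close>

lemma cocycle_exists:
  "\<exists>\<Omega>. SL2Z_cocycle \<Omega> \<and> mero_eq dom0 (\<Omega> T_mat) (\<lambda>_. mat 1) \<and> mero_eq dom0 (\<Omega> S_mat) W"
proof (intro exI conjI)
  define I where "I = mero_rep (\<lambda>_. mat 1 :: complex ^ 'n ^ 'n)"
  define \<Omega> where "\<Omega> = orbit I"
  have I: "I \<in> canonical_mero" and I1: "\<forall>\<^sub>F p in generic dom0. I p = mat 1"
    unfolding I_def by (intro canonical_mero_rep mero_rep invertible_mero_matrix_one)+
  have Om_one: "\<Omega> (mat 1) = I"
    using orbit_Tpow1 [of I 0] by (simp add: \<Omega>_def Tpow_0)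
  have canonical: "\<Omega> \<gamma> \<in> canonical_mero" if "\<gamma> \<in> SL2Z" for \<gamma>
    using that I by (simp add: \<Omega>_def)
  have Om_T: "\<Omega> (T_mat ** \<gamma>) = \<Omega> \<gamma>" for \<gamma>
    by (simp add: \<Omega>_def orbit_T)
  have Om_S: "\<forall>\<^sub>F p in generic dom0. \<Omega> (S_mat ** \<gamma>) p = W (act \<gamma> p) ** \<Omega> \<gamma> p" if "\<gamma> \<in> SL2Z" for \<gamma>
    using step_eq [OF that canonical [OF that]] that I by (simp add: \<Omega>_def orbit_S)
  have mult: "\<forall>\<^sub>F p in generic dom0. \<Omega> (\<gamma> ** \<gamma>') p = \<Omega> \<gamma> (act \<gamma>' p) ** \<Omega> \<gamma>' p"
    if "\<gamma> \<in> SL2Z" and \<gamma>': "\<gamma>' \<in> SL2Z" for \<gamma> \<gamma>'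
    using that(1)
  proof (induction rule: SL2Z_induct)
    case one
    show ?case using generic_act [OF \<gamma>' I1] by eventually_elim (simp add: Om_one)
  next
    case (S \<gamma>)
    then have "\<gamma> ** \<gamma>' \<in> SL2Z" using \<gamma>' by simp
    from Om_S [OF this] generic_act [OF \<gamma>' Om_S [OF S(1)]]
      S(2) eventually_generic_mem [of dom0]
    show ?case
    proof eventually_elim
      case (elim p)
      have "\<Omega> (S_mat ** \<gamma> ** \<gamma>') p = W (act \<gamma> (act \<gamma>' p)) ** (\<Omega> \<gamma> (act \<gamma>' p) ** \<Omega> \<gamma>' p)"
        using elim(1) by (simp only: matrix_mul_assoc [symmetric] elim(3) act_mult_dom0 [OF \<gamma>' elim(4)])
      then show ?case by (simp only: elim(2) matrix_mul_assoc)
    qed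
  next
    case (T \<gamma>)
    then show ?case by (simp add: Om_T flip: matrix_mul_assoc)
  qed
  have "invertible_mero_matrix dom0 (\<Omega> \<gamma>)" if "\<gamma> \<in> SL2Z" for \<gamma>
    using canonical [OF that] by (simp add: canonical_mero_def)
  then show "SL2Z_cocycle \<Omega>"
    using mult by (simp add: SL2Z_cocycle_def mero_eq_dom0)
  have "\<Omega> T_mat = I" using Om_T [of "mat 1"] Om_one by simp
  then show "mero_eq dom0 (\<Omega> T_mat) (\<lambda>_. mat 1)" using I1 by (simp add: mero_eq_dom0)
  show "mero_eq dom0 (\<Omega> S_mat) W"
    unfolding mero_eq_dom0 using Om_S [of "mat 1"] I1
    by (auto simp: Om_one elim: eventually_elim2)
qed

end

section \<open>Extension across the real axis\<close>

text \<open>For \<open>c \<noteq> 0\<close> this is \<open>\<complex> \<times> \<complex>\<^sub>\<gamma>\<close>, whatever the sign of \<open>c\<close>. In terms of the automorphy factor, its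
  behaviour under the action is read off from \<open>autf_mult\<close>.\<close>

definition slit :: "int ^ 2 ^ 2 \<Rightarrow> (complex \<times> complex) set" where
  "slit \<gamma> = {p. Im (snd p) \<noteq> 0 \<or> Re (autf \<gamma> (snd p)) > 0}"

lemma Re_autf: "Re (autf \<gamma> \<tau>) = real_of_int (\<gamma> $ 2 $ 1) * Re \<tau> + real_of_int (\<gamma> $ 2 $ 2)"
  by (simp add: autf_def)

lemma Im_autf: "Im (autf \<gamma> \<tau>) = real_of_int (\<gamma> $ 2 $ 1) * Im \<tau>"
  by (simp add: autf_def)

lemma dom0_slit: "dom0 \<subseteq> slit \<gamma>"
  by (auto simp: slit_def mem_dom0 complex_is_Real_iff)

lemma slit_cut_plane:
  assumes "\<gamma> $ 2 $ 1 \<noteq> 0"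
  shows "UNIV \<times> cut_plane \<gamma> = slit \<gamma>"
proof -
  define c where "c = real_of_int (\<gamma> $ 2 $ 1)"
  define d where "d = real_of_int (\<gamma> $ 2 $ 2)"
  have ray: "\<tau> \<in> complex_of_real ` X \<longleftrightarrow> Im \<tau> = 0 \<and> Re \<tau> \<in> X" for \<tau> X
    by (auto simp: image_iff complex_eq_iff)
  have c: "c \<noteq> 0" using assms by (simp add: c_def)
  have "\<tau> \<in> cut_plane \<gamma> \<longleftrightarrow> Im \<tau> \<noteq> 0 \<or> c * Re \<tau> + d > 0" for \<tau>
  proof (cases "c > 0")
    case True
    then have "\<tau> \<in> cut_plane \<gamma> \<longleftrightarrow> \<not> (Im \<tau> = 0 \<and> Re \<tau> \<le> - d / c)"
      by (simp add: cut_plane_def Let_def ray c_def d_def)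
    then show ?thesis using True by (auto simp: field_simps)
  next
    case False
    then have "\<tau> \<in> cut_plane \<gamma> \<longleftrightarrow> \<not> (Im \<tau> = 0 \<and> Re \<tau> \<ge> - d / c)"
      using c by (simp add: cut_plane_def Let_def ray c_def d_def)
    then show ?thesis using False c by (auto simp: field_simps)
  qed
  then show ?thesis
    by (intro set_eqI) (simp add: slit_def Re_autf c_def d_def mem_Times_iff)
qed

lemma slit_S: "UNIV \<times> - (complex_of_real ` {..0}) = slit S_mat"
proof -
  have "\<tau> \<in> complex_of_real ` {..0} \<longleftrightarrow> Im \<tau> = 0 \<and> Re \<tau> \<le> 0" for \<tau>
    by (auto simp: image_iff complex_eq_iff)
  then show ?thesis
    by (intro set_eqI) (simp add: slit_def Re_autf S_mat_eq mem_Times_iff not_le)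
qed

lemma open_slit: "open (slit \<gamma>)"
  unfolding slit_def Re_autf
  by (intro open_Collect_disj open_Collect_neq open_Collect_less continuous_intros)

lemma slit_regular: "\<gamma> \<in> SL2Z \<Longrightarrow> slit \<gamma> \<subseteq> regular \<gamma>"
  using autf_nonzero [of \<gamma>] by (intro subsetI) (force simp: slit_def regular_def complex_is_Real_iff)

lemma slit_pos:
  assumes "p \<in> slit \<gamma>" "snd p \<in> \<real>"
  shows "autf \<gamma> (snd p) = complex_of_real (Re (autf \<gamma> (snd p)))" "Re (autf \<gamma> (snd p)) > 0"
  using assms by (auto simp: slit_def complex_is_Real_iff Im_autf complex_eq_iff)

text \<open>At real points all automorphy factors are real. In \<open>autf_mult\<close> the product
  and the factor of \<open>\<delta>\<close> are positive, hence so is the factor of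
  \<open>\<gamma>\<close> at the image.\<close>

lemma act_slit:
  assumes \<delta>: "\<delta> \<in> SL2Z" and p: "p \<in> slit \<delta>" "p \<in> slit (\<gamma> ** \<delta>)"
  shows "act \<delta> p \<in> slit \<gamma>"
proof (cases "snd p \<in> \<real>")
  case False
  then show ?thesis
    using act_dom0 [OF \<delta>, of p] dom0_slit [of \<gamma>] by (auto simp: mem_dom0)
next
  case True
  have "autf \<delta> (snd p) \<noteq> 0" using slit_regular [OF \<delta>] p(1) by (auto simp: regular_def)
  from autf_mult [OF this, of \<gamma>]
  have "complex_of_real (Re (autf (\<gamma> ** \<delta>) (snd p))) =
      autf \<gamma> (snd (act \<delta> p)) * complex_of_real (Re (autf \<delta> (snd p)))"
    using slit_pos(1) [OF p(1) True] slit_pos(1) [OF p(2) True] by simp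
  from arg_cong [OF this, of Re]
  have "Re (autf (\<gamma> ** \<delta>) (snd p)) = Re (autf \<gamma> (snd (act \<delta> p))) * Re (autf \<delta> (snd p))"
    by simp
  then have "Re (autf \<gamma> (snd (act \<delta> p))) > 0"
    using slit_pos(2) [OF p(1) True] slit_pos(2) [OF p(2) True] by (metis zero_less_mult_pos2)
  then show ?thesis by (simp add: slit_def)
qed

lemma coprime_bezout_range:
  fixes c d :: int
  assumes "coprime c d" "c > 0"
  obtains e f where "c * f - d * e = 1" "0 \<le> e" "e < c"
proof -
  obtain x y where xy: "c * x + d * y = 1"
    using assms(1) by (metis bezout_int coprime_iff_gcd_eq_1 mult.commute)
  show ?thesis
  proof
    \<comment> \<open>The Bezout coefficient \<open>- y\<close> is reduced modulo \<open>c\<close>,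
      and the multiple of \<open>c\<close> removed from it is compensated in the other
      coefficient.\<close>
    have "c * (x - d * ((- y) div c)) - d * ((- y) mod c) = c * x + d * y"
      by (simp add: minus_mult_div_eq_mod [symmetric] algebra_simps)
    then show "c * (x - d * ((- y) div c)) - d * ((- y) mod c) = 1" using xy by simp
  qed (use assms in auto)
qed

context T_trivial_cocycle
begin

lemma extends_slitI:
  assumes "mero_matrix (slit \<gamma>) G" "\<forall>\<^sub>F p in generic dom0. G p = \<Omega> \<gamma> p"
  shows "extends_mero dom0 (slit \<gamma>) (\<Omega> \<gamma>)"
  using assms by (auto simp: extends_mero_def mero_eq_dom0)

lemma extends_slitE:
  assumes "extends_mero dom0 (slit \<gamma>) (\<Omega> \<gamma>)"
  obtains G where "mero_matrix (slit \<gamma>) G" "\<forall>\<^sub>F p in generic dom0. G p = \<Omega> \<gamma> p"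
  using assms unfolding extends_mero_def mero_eq_dom0 by (elim exE conjE) (rule that)

lemma cocycle_Tpow_mult:
  assumes "\<gamma> \<in> SL2Z"
  shows "\<forall>\<^sub>F p in generic dom0. \<Omega> (Tpow k ** \<gamma>) p = \<Omega> \<gamma> p"
  using cocycle_mult [OF Tpow_SL2Z assms, of k] generic_act [OF assms cocycle_Tpow [of k]]
  by eventually_elim simp

text \<open>Strong induction on \<open>c\<close>. The side condition for \<open>c = 0\<close> leaves
  the powers of \<open>T\<close>, whose slit is the whole space and where the constant identity is
  the extension. The induction meets this case at \<open>e = 0\<close>, which forces
  \<open>f = 1\<close>.\<close>

lemma extends_slit_nonneg:
  assumes S: "extends_mero dom0 (slit S_mat) (\<Omega> S_mat)"
    and "\<gamma> \<in> SL2Z" "\<gamma> $ 2 $ 1 \<ge> 0" "\<gamma> $ 2 $ 1 = 0 \<Longrightarrow> \<gamma> $ 2 $ 2 = 1"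
  shows "extends_mero dom0 (slit \<gamma>) (\<Omega> \<gamma>)"
  using assms(2-)
proof (induction "nat (\<gamma> $ 2 $ 1)" arbitrary: \<gamma> rule: less_induct)
  case less
  show ?case
  proof (cases \<gamma> rule: mat2_cases)
    case (mat2 a b c d)
    show ?thesis
    proof (cases "c = 0")
      case True
      then have "\<gamma> = Tpow b" using less.prems by (simp add: mat2 Tpow_def)
      then show ?thesis using cocycle_Tpow [of b]
        by (intro extends_slitI [where G = "\<lambda>_. mat 1"] mero_matrix_const) (simp add: eq_commute [of "mat 1"])
    next
      case False
      then have c: "c > 0" using less.prems by (simp add: mat2)
      have det: "a * d - b * c = 1" using less.prems(1) by (simp add: mat2)
      have "coprime c d"
      proof (rule coprimeI)
        fix l assume "l dvd c" "l dvd d"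
        then have "l dvd a * d - b * c" by simp
        then show "l dvd 1" by (simp add: det)
      qed
      then obtain e f where ef: "c * f - d * e = 1" "0 \<le> e" "e < c"
        using c by (rule coprime_bezout_range)
      define \<delta> where "\<delta> = mat2 c d e f"
      have \<delta>: "\<delta> \<in> SL2Z" using ef by (simp add: \<delta>_def)
      have "extends_mero dom0 (slit \<delta>) (\<Omega> \<delta>)"
      proof (rule less.hyps)
        show "\<delta> $ 2 $ 2 = 1" if "\<delta> $ 2 $ 1 = 0"
          using that ef c by (auto simp: \<delta>_def zmult_eq_1_iff)
      qed (use \<delta> ef c in \<open>simp_all add: \<delta>_def mat2\<close>)
      then obtain G where G: "mero_matrix (slit \<delta>) G" "\<forall>\<^sub>F p in generic dom0. G p = \<Omega> \<delta> p"
        by (rule extends_slitE)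
      obtain H where H: "mero_matrix (slit S_mat) H" "\<forall>\<^sub>F p in generic dom0. H p = \<Omega> S_mat p"
        using S by (rule extends_slitE)
      \<comment> \<open>S \<open>\<delta>\<close> has rows (-e, -f) and (c, d). It shares its lower
        row with \<open>\<gamma>\<close>, so the two differ by a power of \<open>T\<close>, whose
        exponent is \<open>k\<close>.\<close>
      define k where "k = a * f - b * e"
      have "a = k * c - e" "b = k * d - f"
        unfolding k_def using det ef(1) by algebra+
      then have \<gamma>: "\<gamma> = Tpow k ** (S_mat ** \<delta>)"
        by (simp add: mat2 \<delta>_def S_mat_eq Tpow_def)
      have autf: "autf (S_mat ** \<delta>) = autf \<gamma>"
        by (rule ext) (simp add: mat2 \<delta>_def S_mat_eq autf_mat2)
      \<comment> \<open>At a real point, c (e x + f) = e (c x + d) + 1, which is positive because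
        \<open>e\<close> is nonnegative.\<close>
      have sub: "slit \<gamma> \<subseteq> slit \<delta>"
      proof
        fix p assume p: "p \<in> slit \<gamma>"
        show "p \<in> slit \<delta>"
        proof (cases "Im (snd p) = 0")
          case True
          define x where "x = Re (snd p)"
          have "real_of_int c * x + real_of_int d > 0"
            using p True by (simp add: slit_def Re_autf mat2 x_def)
          then have "real_of_int e * (real_of_int c * x + real_of_int d) \<ge> 0"
            using ef(2) by simp
          moreover have "real_of_int c * real_of_int f - real_of_int d * real_of_int e = 1"
            using ef(1) by (metis of_int_1 of_int_diff of_int_mult)
          ultimately have "real_of_int c * (real_of_int e * x + real_of_int f) > 0"
            by (simp add: algebra_simps)
          then have "real_of_int e * x + real_of_int f > 0"
            using c by (simp add: zero_less_mult_iff)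
          then show ?thesis by (simp add: slit_def Re_autf \<delta>_def x_def)
        qed (simp add: slit_def)
      qed
      have maps: "act \<delta> ` slit \<gamma> \<subseteq> slit S_mat"
      proof (rule image_subsetI)
        fix p assume p: "p \<in> slit \<gamma>"
        then have "p \<in> slit (S_mat ** \<delta>)" by (simp add: slit_def autf)
        moreover have "p \<in> slit \<delta>" using p sub by (rule subsetD [rotated])
        ultimately show "act \<delta> p \<in> slit S_mat" by (intro act_slit \<delta>)
      qed
      show ?thesis
      proof (rule extends_slitI)
        show "mero_matrix (slit \<gamma>) (\<lambda>p. H (act \<delta> p) ** G p)"
          using mero_matrix_act [OF \<delta> H(1) open_slit subset_trans [OF sub slit_regular [OF \<delta>]] maps]
            mero_matrix_subset [OF G(1) sub]
          by (rule mero_matrix_mult)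
        have "\<forall>\<^sub>F p in generic dom0. \<Omega> (S_mat ** \<delta>) p = \<Omega> S_mat (act \<delta> p) ** \<Omega> \<delta> p"
          using \<delta> by (simp add: cocycle_mult)
        moreover have "\<forall>\<^sub>F p in generic dom0. \<Omega> \<gamma> p = \<Omega> (S_mat ** \<delta>) p"
          unfolding \<gamma> using \<delta> by (simp add: cocycle_Tpow_mult)
        ultimately show "\<forall>\<^sub>F p in generic dom0. H (act \<delta> p) ** G p = \<Omega> \<gamma> p"
          using G(2) generic_act [OF \<delta> H(2)] by eventually_elim simp
      qed
    qed
  qed
qed

lemma extends_slit:
  assumes S: "extends_mero dom0 (slit S_mat) (\<Omega> S_mat)"
    and \<gamma>: "\<gamma> \<in> SL2Z" "\<gamma> $ 2 $ 1 \<noteq> 0"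
  shows "extends_mero dom0 (slit \<gamma>) (\<Omega> \<gamma>)"
proof (cases "\<gamma> $ 2 $ 1 > 0")
  case True
  then show ?thesis using extends_slit_nonneg [OF S \<gamma>(1)] by simp
next
  case False
  let ?\<delta> = "SL2Z_inv \<gamma>"
  note inv = SL2Z_inv [OF \<gamma>(1)]
  have "?\<delta> $ 2 $ 1 > 0" using False \<gamma>(2) by (simp add: SL2Z_inv_def)
  then have "extends_mero dom0 (slit ?\<delta>) (\<Omega> ?\<delta>)"
    using extends_slit_nonneg [OF S inv(1)] by simp
  then obtain G where G: "mero_matrix (slit ?\<delta>) G" "\<forall>\<^sub>F p in generic dom0. G p = \<Omega> ?\<delta> p"
    by (rule extends_slitE)
  have maps: "act \<gamma> ` slit \<gamma> \<subseteq> slit ?\<delta>"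
  proof (rule image_subsetI)
    fix p assume p: "p \<in> slit \<gamma>"
    \<comment> \<open>The product is the identity matrix, whose automorphy factor is 1
      everywhere.\<close>
    have "p \<in> slit (?\<delta> ** \<gamma>)" unfolding inv by (simp add: slit_def)
    then show "act \<gamma> p \<in> slit ?\<delta>" by (rule act_slit [OF \<gamma>(1) p])
  qed
  have mero: "mero_matrix (slit \<gamma>) (\<lambda>p. G (act \<gamma> p))"
    by (rule mero_matrix_act [OF \<gamma>(1) G(1) open_slit slit_regular [OF \<gamma>(1)] maps])
  have "\<forall>\<^sub>F p in generic dom0. \<Omega> (?\<delta> ** \<gamma>) p = \<Omega> ?\<delta> (act \<gamma> p) ** \<Omega> \<gamma> p"
    using inv(1) \<gamma>(1) by (rule cocycle_mult)
  then have left_inv: "\<forall>\<^sub>F p in generic dom0. G (act \<gamma> p) ** \<Omega> \<gamma> p = mat 1"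
    unfolding inv using cocycle_one generic_act [OF \<gamma>(1) G(2)] by eventually_elim simp
  then have det: "\<forall>\<^sub>F p in generic dom0. det (G (act \<gamma> p)) \<noteq> 0"
    by eventually_elim (metis det_I det_mul mult_zero_left zero_neq_one)
  \<comment> \<open>The determinant is known to be nonzero only generically on \<open>dom0\<close>;
    density carries this to the slit domain, where the inverse has to be meromorphic.\<close>
  have "slit \<gamma> \<subseteq> closure dom0" by (simp add: closure_dom0)
  then have det': "\<forall>\<^sub>F p in generic (slit \<gamma>). det (G (act \<gamma> p)) \<noteq> 0"
    by (rule generic_dense_subset [OF open_dom0 _ det])
  show ?thesis
  proof (rule mero_matrix_inverse [OF mero open_slit det'])
    fix K assume "mero_matrix (slit \<gamma>) K"
      and K: "\<And>p. det (G (act \<gamma> p)) \<noteq> 0 \<Longrightarrow> G (act \<gamma> p) ** K p = mat 1 \<and> K p ** G (act \<gamma> p) = mat 1"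
    moreover have "\<forall>\<^sub>F p in generic dom0. K p = \<Omega> \<gamma> p"
      using det left_inv
    proof eventually_elim
      case (elim p)
      have "K p = K p ** (G (act \<gamma> p) ** \<Omega> \<gamma> p)" by (simp only: elim(2) matrix_mul_rid)
      also have "\<dots> = (K p ** G (act \<gamma> p)) ** \<Omega> \<gamma> p" by (rule matrix_mul_assoc)
      finally show ?case using K [OF elim(1)] by simp
    qed
    ultimately show ?thesis by (intro extends_slitI)
  qed
qed

end

theorem theorem1p2:
  shows
    "(\<forall>(A :: rat poly poly fract ^ 'n ^ 'n) U V \<kappa>\<^sub>U \<kappa>\<^sub>V.
        invertible A \<and> fundamental_solution A U \<and> fundamental_solution A V \<and>
        modular_eq \<kappa>\<^sub>U \<kappa>\<^sub>V (monodromy U V) S_mat \<and>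
        modular_eq \<kappa>\<^sub>U \<kappa>\<^sub>V (monodromy U V) T_mat
        \<longrightarrow> (\<forall>\<gamma>\<in>SL2Z. modular_eq \<kappa>\<^sub>U \<kappa>\<^sub>V (monodromy U V) \<gamma>))
     \<and>
     (\<forall>\<Omega> :: int ^ 2 ^ 2 \<Rightarrow> complex \<times> complex \<Rightarrow> complex ^ 'n ^ 'n.
        SL2Z_cocycle \<Omega> \<and> mero_eq dom0 (\<Omega> T_mat) (\<lambda>_. mat 1) \<longrightarrow> S_equations (\<Omega> S_mat))
     \<and>
     (\<forall>W :: complex \<times> complex \<Rightarrow> complex ^ 'n ^ 'n.
        invertible_mero_matrix dom0 W \<and> S_equations W \<longrightarrow>
        (\<exists>\<Omega>. SL2Z_cocycle \<Omega> \<and> mero_eq dom0 (\<Omega> T_mat) (\<lambda>_. mat 1) \<and> mero_eq dom0 (\<Omega> S_mat) W))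
     \<and>
     (\<forall>\<Omega> :: int ^ 2 ^ 2 \<Rightarrow> complex \<times> complex \<Rightarrow> complex ^ 'n ^ 'n.
        SL2Z_cocycle \<Omega> \<and> mero_eq dom0 (\<Omega> T_mat) (\<lambda>_. mat 1) \<and>
        extends_mero dom0 (UNIV \<times> (- (complex_of_real ` {..0}))) (\<Omega> S_mat)
        \<longrightarrow> (\<forall>\<gamma>\<in>SL2Z. extends_mero dom0 (UNIV \<times> cut_plane \<gamma>) (\<Omega> \<gamma>)))"
proof (intro conjI allI impI ballI; (elim conjE)?)
  fix \<gamma> and \<Omega> :: "int ^ 2 ^ 2 \<Rightarrow> complex \<times> complex \<Rightarrow> complex ^ 'n ^ 'n"
  assume \<gamma>: "\<gamma> \<in> SL2Z" and *: "SL2Z_cocycle \<Omega>" "mero_eq dom0 (\<Omega> T_mat) (\<lambda>_. mat 1)"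
    and S: "extends_mero dom0 (UNIV \<times> (- (complex_of_real ` {..0}))) (\<Omega> S_mat)"
  interpret T_trivial_cocycle \<Omega> by unfold_locales (rule *)+
  show "extends_mero dom0 (UNIV \<times> cut_plane \<gamma>) (\<Omega> \<gamma>)"
  proof (cases "\<gamma> $ 2 $ 1 = 0")
    case True
    \<comment> \<open>For \<open>c = 0\<close> the target domain is the original one, and
      \<open>\<Omega> \<gamma>\<close> is its own extension.\<close>
    then have "UNIV \<times> cut_plane \<gamma> = dom0" by (simp add: cut_plane_def dom0_def)
    then show ?thesis
      unfolding extends_mero_def mero_eq_dom0
      using cocycle_mero [OF \<gamma>] by (intro exI [of _ "\<Omega> \<gamma>"]) simp
  next
    case False
    then show ?thesis
      using extends_slit [OF S [unfolded slit_S] \<gamma>] by (simp add: slit_cut_plane)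
  qed
next
  fix W :: "complex \<times> complex \<Rightarrow> complex ^ 'n ^ 'n"
  assume "invertible_mero_matrix dom0 W" "S_equations W"
  then interpret S_equations_solution W by unfold_locales
  show "\<exists>\<Omega>. SL2Z_cocycle \<Omega> \<and> mero_eq dom0 (\<Omega> T_mat) (\<lambda>_. mat 1) \<and> mero_eq dom0 (\<Omega> S_mat) W"
    by (rule cocycle_exists)
next
  fix \<Omega> :: "int ^ 2 ^ 2 \<Rightarrow> complex \<times> complex \<Rightarrow> complex ^ 'n ^ 'n"
  assume "SL2Z_cocycle \<Omega>" "mero_eq dom0 (\<Omega> T_mat) (\<lambda>_. mat 1)"
  then interpret T_trivial_cocycle \<Omega> by unfold_locales
  show "S_equations (\<Omega> S_mat)" by (rule cocycle_S_equations)
qed (rule modular_eq_generators)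

end
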